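(* Let $F\in H^2(T_{\Gamma_1})$ and let $\alpha=(\alpha_1,\dots,\alpha_n)$ be an $n$-tuple of non-negative integers. Then, with $z=x+iy\in T_{\Gamma_1}$, $$\lim_{y\in\Gamma_1,\ |y|\to\infty}\frac{|\langle F,\phi_{\alpha,z}\rangle|}{\|\phi_{\alpha,z}\|}=0$$ uniformly for $x\in\mathbb R^n$.
   Context: $\Gamma_1=\{y\in\mathbb R^n: y_1>0,\dots,y_n>0\}$, $T_{\Gamma_1}=\{x+iy: x\in\mathbb R^n,\ y\in\Gamma_1\}\subset\mathbb C^n$. $H^2(T_{\Gamma_1})$ is the space of holomorphic $F$ on $T_{\Gamma_1}$ with $\|F\|^2=\sup_{y\in\Gamma_1}\int_{\mathbb R^n}|F(x+iy)|^2dx<\infty$; it is a Hilbert space with inner product $\langle F,G\rangle=\int_{\mathbb R^n}F(\xi)\overline{G(\xi)}\,d\xi$, where $F(\xi)=\lim_{\eta\in\Gamma_1,\eta\to0}F(\xi+i\eta)$ is the $L^2$ boundary limit. Its reproducing kernel is $K_{\Gamma_1}(w,\overline z)=\prod_{k=1}^n\frac{-1}{2\pi i(w_k-\overline z_k)}$. For $z\in T_{\Gamma_1}$, $$\phi_{\alpha,z}(w)=\frac{\partial^{|\alpha|}K_{\Gamma_1}(w,\overline z)}{\partial\overline z_1^{\alpha_1}\cdots\partial\overline z_n^{\alpha_n}}=\Big(\frac{-1}{2\pi i}\Big)^n\prod_{j=1}^n\frac{\alpha_j!}{(w_j-\overline z_j)^{\alpha_j+1}} .$$ *)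

theory Defs
  imports "HOL-Analysis.Analysis"
begin

text \<open>
  The dimension \<open>n\<close> is the cardinality of the finite index type \<open>'n\<close>; the spaces
  \<open>\<real>^n\<close> and \<open>\<complex>^n\<close> are \<open>real ^ 'n\<close> and \<open>complex ^ 'n\<close>, and a multi-index is a
  function \<open>'n \<Rightarrow> nat\<close>.
\<close>

definition octant :: "(real ^ 'n) set" where
  "octant = {y. \<forall>k. y $ k > 0}"

definition cvec :: "real ^ 'n \<Rightarrow> real ^ 'n \<Rightarrow> complex ^ 'n" where
  "cvec x y = (\<chi> k. of_real (x $ k) + \<i> * of_real (y $ k))"

definition tube :: "(real ^ 'n) set \<Rightarrow> (complex ^ 'n) set" where
  "tube \<Gamma> = {cvec x y | x y. y \<in> \<Gamma>}"

text \<open>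
  The library's \<open>holomorphic_on\<close> is for one variable.  A function on an open subset of \<open>\<complex>^n\<close>
  is holomorphic if at every point it has a (Frechet) derivative that is complex linear.
\<close>

definition holomorphic_several :: "(complex ^ 'n \<Rightarrow> complex) \<Rightarrow> (complex ^ 'n) set \<Rightarrow> bool" where
  "holomorphic_several F S \<longleftrightarrow>
     (\<forall>z\<in>S. \<exists>a :: complex ^ 'n. (F has_derivative (\<lambda>h. \<Sum>j\<in>UNIV. a $ j * h $ j)) (at z))"

definition hardy_norm_sq :: "(complex ^ 'n \<Rightarrow> complex) \<Rightarrow> ennreal" where
  "hardy_norm_sq F =
     (SUP y\<in>octant. \<integral>\<^sup>+ x. ennreal ((cmod (F (cvec x y)))\<^sup>2) \<partial>lborel)"

definition hardy_space :: "(complex ^ 'n \<Rightarrow> complex) set" where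
  "hardy_space = {F. holomorphic_several F (tube octant) \<and> hardy_norm_sq F < \<infinity>}"

definition hardy_norm :: "(complex ^ 'n \<Rightarrow> complex) \<Rightarrow> real" where
  "hardy_norm F = sqrt (enn2real (hardy_norm_sq F))"

text \<open>
  The boundary function is the limit of the slices \<open>F(\<cdot> + i\<eta>)\<close> in \<open>L^2\<close>; it is determined
  only up to null sets, so \<open>boundary_fun\<close> picks a representative.  The inner product
  does not depend on this choice.
\<close>

definition is_boundary_fun :: "(complex ^ 'n \<Rightarrow> complex) \<Rightarrow> (real ^ 'n \<Rightarrow> complex) \<Rightarrow> bool" where
  "is_boundary_fun F f \<longleftrightarrow>
     f \<in> borel_measurable lborel \<and>
     (\<integral>\<^sup>+ x. ennreal ((cmod (f x))\<^sup>2) \<partial>lborel) < \<infinity> \<and>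
     ((\<lambda>\<eta>. \<integral>\<^sup>+ x. ennreal ((cmod (F (cvec x \<eta>) - f x))\<^sup>2) \<partial>lborel) \<longlongrightarrow> 0)
       (at 0 within octant)"

definition boundary_fun :: "(complex ^ 'n \<Rightarrow> complex) \<Rightarrow> real ^ 'n \<Rightarrow> complex" where
  "boundary_fun F = (SOME f. is_boundary_fun F f)"

definition hardy_inner :: "(complex ^ 'n \<Rightarrow> complex) \<Rightarrow> (complex ^ 'n \<Rightarrow> complex) \<Rightarrow> complex" where
  "hardy_inner F G = (LINT \<xi>|lborel. boundary_fun F \<xi> * cnj (boundary_fun G \<xi>))"

text \<open>\<open>szego_kernel w z\<close> is \<open>K(w, cnj z)\<close>: the conjugation of the second variable is built in.\<close>

definition szego_kernel :: "complex ^ 'n \<Rightarrow> complex ^ 'n \<Rightarrow> complex" where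
  "szego_kernel w z = (\<Prod>k\<in>UNIV. - 1 / (2 * of_real pi * \<i> * (w $ k - cnj (z $ k))))"

text \<open>
  The Wirtinger derivative \<open>\<partial>/\<partial>(cnj z\<^sub>j) = (\<partial>/\<partial>x\<^sub>j + i \<partial>/\<partial>y\<^sub>j) / 2\<close>.
\<close>

definition dbar :: "'n \<Rightarrow> (complex ^ 'n \<Rightarrow> complex) \<Rightarrow> complex ^ 'n \<Rightarrow> complex" where
  "dbar j f z =
     (vector_derivative (\<lambda>t::real. f (z + axis j (of_real t))) (at 0)
      + \<i> * vector_derivative (\<lambda>t::real. f (z + axis j (\<i> * of_real t))) (at 0)) / 2"

text \<open>
  The partial derivatives are taken in some enumeration of the coordinates; for the
  kernel the order is irrelevant, see \<open>phi_closed_form\<close>.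
\<close>

definition dbar_multi :: "('n::finite \<Rightarrow> nat) \<Rightarrow> (complex ^ 'n \<Rightarrow> complex) \<Rightarrow> complex ^ 'n \<Rightarrow> complex"
  where
  "dbar_multi \<alpha> f =
     fold (\<lambda>j. dbar j ^^ \<alpha> j) (SOME js. distinct js \<and> set js = (UNIV :: 'n set)) f"

definition phi :: "('n::finite \<Rightarrow> nat) \<Rightarrow> complex ^ 'n \<Rightarrow> complex ^ 'n \<Rightarrow> complex" where
  "phi \<alpha> z w = dbar_multi \<alpha> (szego_kernel w) z"

lemma mem_tube_octant: "z \<in> tube octant \<longleftrightarrow> (\<forall>k. Im (z $ k) > 0)"
proof
  assume "\<forall>k. Im (z $ k) > 0"
  then have "z = cvec (\<chi> k. Re (z $ k)) (\<chi> k. Im (z $ k)) \<and> (\<chi> k. Im (z $ k)) \<in> octant"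
    by (simp add: cvec_def octant_def vec_eq_iff complex_eq_iff)
  then show "z \<in> tube octant" unfolding tube_def by blast
qed (auto simp: tube_def octant_def cvec_def)

definition phi_formula :: "complex ^ 'n \<Rightarrow> ('n::finite \<Rightarrow> nat) \<Rightarrow> complex ^ 'n \<Rightarrow> complex" where
  "phi_formula w \<beta> z = (- 1 / (2 * of_real pi * \<i>)) ^ CARD('n) *
     (\<Prod>j\<in>UNIV. fact (\<beta> j) / (w $ j - cnj (z $ j)) ^ (\<beta> j + 1))"

lemma eventually_tube_axis:
  fixes z :: "complex ^ 'n"
  assumes z: "z \<in> tube octant"
  shows "eventually (\<lambda>t::real. z + axis j (c * of_real t) \<in> tube octant) (nhds 0)"
proof -
  have "((\<lambda>t::real. Im (z $ j + c * of_real t)) \<longlongrightarrow> Im (z $ j + c * of_real 0)) (nhds 0)"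
    by (intro tendsto_intros filterlim_ident)
  then have "eventually (\<lambda>t::real. Im (z $ j + c * of_real t) > 0) (nhds 0)"
    by (rule order_tendstoD) (use z in \<open>simp add: mem_tube_octant\<close>)
  then show ?thesis
    by eventually_elim (use z in \<open>auto simp: mem_tube_octant axis_def\<close>)
qed

lemma dbar_cong:
  assumes "z \<in> tube octant" "\<And>u. u \<in> tube octant \<Longrightarrow> f u = g u"
  shows "dbar j f z = dbar j g z"
proof -
  have *: "vector_derivative (\<lambda>t::real. f (z + axis j (c * of_real t))) (at 0)
      = vector_derivative (\<lambda>t::real. g (z + axis j (c * of_real t))) (at 0)" for c
  proof (rule vector_derivative_cong_eq)
    have "\<forall>\<^sub>F t in nhds (0::real). f (z + axis j (c * of_real t)) = g (z + axis j (c * of_real t))"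
      using eventually_tube_axis[OF assms(1)] by eventually_elim (use assms(2) in auto)
    then show "\<forall>\<^sub>F t in nhds (0::real). t \<in> UNIV \<longrightarrow>
       f (z + axis j (c * of_real t)) = g (z + axis j (c * of_real t))" by simp
  qed auto
  show ?thesis using *[of 1] *[of \<i>] by (simp add: dbar_def)
qed

lemma dbar_phi_formula:
  fixes z w :: "complex ^ 'n"
  assumes z: "z \<in> tube octant" and w: "w \<in> tube octant"
  shows "dbar j (phi_formula w \<beta>) z = phi_formula w (\<beta>(j := Suc (\<beta> j))) z"
proof -
  define C where "C = (- 1 / (2 * of_real pi * \<i>)) ^ CARD('n) *
     (\<Prod>k\<in>UNIV - {j}. fact (\<beta> k) / (w $ k - cnj (z $ k)) ^ (\<beta> k + 1))"
  define d where "d = w $ j - cnj (z $ j)"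
  have "Im d > 0" using z w by (simp add: d_def mem_tube_octant add_pos_pos)
  then have d0: "d \<noteq> 0" by auto
  have eq: "phi_formula w \<beta> (z + axis j u) = C * (fact (\<beta> j) / (d - cnj u) ^ (\<beta> j + 1))" for u
  proof -
    have "(\<Prod>k\<in>UNIV - {j}. fact (\<beta> k) / (w $ k - cnj ((z + axis j u) $ k)) ^ (\<beta> k + 1))
        = (\<Prod>k\<in>UNIV - {j}. fact (\<beta> k) / (w $ k - cnj (z $ k)) ^ (\<beta> k + 1))"
      by (intro prod.cong) (auto simp: axis_def)
    then show ?thesis
      unfolding phi_formula_def C_def
      by (subst prod.remove[of _ j]) (auto simp: d_def axis_def algebra_simps)
  qed
  have goal: "phi_formula w (\<beta>(j := Suc (\<beta> j))) z = C * (fact (Suc (\<beta> j)) / d ^ (\<beta> j + 2))"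
  proof -
    have "(\<Prod>k\<in>UNIV - {j}. fact ((\<beta>(j := Suc (\<beta> j))) k) / (w $ k - cnj (z $ k)) ^ ((\<beta>(j := Suc (\<beta> j))) k + 1))
        = (\<Prod>k\<in>UNIV - {j}. fact (\<beta> k) / (w $ k - cnj (z $ k)) ^ (\<beta> k + 1))"
      by (intro prod.cong) auto
    then show ?thesis
      unfolding phi_formula_def C_def
      by (subst prod.remove[of _ j]) (auto simp: d_def)
  qed
  have vd: "vector_derivative (\<lambda>t::real. phi_formula w \<beta> (z + axis j (c * of_real t))) (at 0)
      = cnj c * (C * (fact (Suc (\<beta> j)) / d ^ (\<beta> j + 2)))" for c
  proof (rule vector_derivative_at)
    have "((\<lambda>u. C * (fact (\<beta> j) / (d - cnj c * u) ^ (\<beta> j + 1))) has_field_derivative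
        C * (fact (\<beta> j) * (of_nat (\<beta> j + 1) * cnj c * d ^ \<beta> j) / (d ^ (\<beta> j + 1))\<^sup>2))
        (at (of_real 0))"
      using d0 by (auto intro!: derivative_eq_intros simp del: power_Suc simp: power2_eq_square mult_ac)
    also have "C * (fact (\<beta> j) * (of_nat (\<beta> j + 1) * cnj c * d ^ \<beta> j) / (d ^ (\<beta> j + 1))\<^sup>2)
        = cnj c * (C * (fact (Suc (\<beta> j)) / d ^ (\<beta> j + 2)))"
      using d0 by (simp add: divide_simps power2_eq_square)
    finally have "((\<lambda>u. C * (fact (\<beta> j) / (d - cnj c * u) ^ (\<beta> j + 1))) has_field_derivative
        cnj c * (C * (fact (Suc (\<beta> j)) / d ^ (\<beta> j + 2)))) (at (of_real 0))" .
    from has_vector_derivative_real_field[OF this]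
    show "((\<lambda>t::real. phi_formula w \<beta> (z + axis j (c * of_real t))) has_vector_derivative
        cnj c * (C * (fact (Suc (\<beta> j)) / d ^ (\<beta> j + 2)))) (at 0)"
      by (simp add: eq)
  qed
  show ?thesis
    using vd[of 1] vd[of \<i>] unfolding dbar_def goal by simp
qed

lemma dbar_iterate_phi_formula:
  fixes w :: "complex ^ 'n"
  assumes w: "w \<in> tube octant" and f: "\<And>u. u \<in> tube octant \<Longrightarrow> f u = phi_formula w \<beta> u"
    and z: "z \<in> tube octant"
  shows "(dbar j ^^ m) f z = phi_formula w (\<beta>(j := \<beta> j + m)) z"
  using z
proof (induction m arbitrary: z)
  case (Suc m)
  have "(dbar j ^^ Suc m) f z = dbar j (phi_formula w (\<beta>(j := \<beta> j + m))) z"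
    using Suc.prems Suc.IH by (simp only: funpow.simps o_apply) (rule dbar_cong)
  then show ?case using dbar_phi_formula[OF Suc.prems w, of j "\<beta>(j := \<beta> j + m)"]
    by (simp del: fun_upd_apply add: fun_upd_same)
qed (use f in simp)

lemma dbar_fold_phi_formula:
  fixes w :: "complex ^ 'n"
  assumes w: "w \<in> tube octant" and "\<And>u. u \<in> tube octant \<Longrightarrow> f u = phi_formula w \<beta> u"
    and "z \<in> tube octant" "distinct js"
  shows "fold (\<lambda>j. dbar j ^^ \<alpha> j) js f z =
    phi_formula w (\<lambda>k. if k \<in> set js then \<beta> k + \<alpha> k else \<beta> k) z"
  using assms(2-)
proof (induction js arbitrary: f \<beta> z)
  case (Cons j js)
  have "fold (\<lambda>j. dbar j ^^ \<alpha> j) js ((dbar j ^^ \<alpha> j) f) z = phi_formula w (\<lambda>k. if k \<in> set js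
      then (\<beta>(j := \<beta> j + \<alpha> j)) k + \<alpha> k else (\<beta>(j := \<beta> j + \<alpha> j)) k) z"
    using Cons.prems by (intro Cons.IH dbar_iterate_phi_formula[OF w]) auto
  also have "(\<lambda>k. if k \<in> set js
      then (\<beta>(j := \<beta> j + \<alpha> j)) k + \<alpha> k else (\<beta>(j := \<beta> j + \<alpha> j)) k)
     = (\<lambda>k. if k \<in> set (j # js) then \<beta> k + \<alpha> k else \<beta> k)"
    using Cons.prems by auto
  finally show ?case by simp
qed simp

lemma phi_closed_form:
  fixes z w :: "complex ^ 'n"
  assumes z: "z \<in> tube octant" and w: "w \<in> tube octant"
  shows "phi \<alpha> z w = (- 1 / (2 * of_real pi * \<i>)) ^ CARD('n) *
     (\<Prod>j\<in>UNIV. fact (\<alpha> j) / (w $ j - cnj (z $ j)) ^ (\<alpha> j + 1))"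
proof -
  define js where "js = (SOME js. distinct js \<and> set js = (UNIV :: 'n set))"
  have js: "distinct js \<and> set js = (UNIV :: 'n set)"
    unfolding js_def by (rule someI_ex) (use finite_distinct_list[of "UNIV :: 'n set"] in auto)
  have K: "szego_kernel w u = phi_formula w (\<lambda>_. 0) u" for u
  proof -
    have "szego_kernel w u
        = (\<Prod>k\<in>UNIV. (- 1 / (2 * of_real pi * \<i>)) * (1 / (w $ k - cnj (u $ k))))"
      unfolding szego_kernel_def by (intro prod.cong) auto
    then show ?thesis by (simp only: prod.distrib) (simp add: phi_formula_def)
  qed
  have "phi \<alpha> z w = phi_formula w (\<lambda>k. if k \<in> set js then 0 + \<alpha> k else 0) z"
    unfolding phi_def dbar_multi_def js_def[symmetric]
    using js by (intro dbar_fold_phi_formula w z K) auto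
  then show ?thesis using js by (simp add: phi_formula_def)
qed

end

theory Submission
  imports Defs "HOL-Complex_Analysis.Cauchy_Integral_Theorem"
begin

text \<open>
  Only the boundary function \<open>f \<in> L\<^sup>2\<close> of \<open>F\<close> matters: divided by their norms, the kernels are
  dominated by a constant times \<open>\<Prod>j. sqrt y\<^sub>j / \<bar>\<xi>\<^sub>j - x\<^sub>j + i y\<^sub>j\<bar>\<close>, which is bounded in \<open>L\<^sup>2\<close> and tends to
  \<open>0\<close> in \<open>L\<^sup>1\<close> of every box, uniformly in \<open>x\<close>, as \<open>\<bar>y\<bar> \<rightarrow> \<infinity>\<close>.

  That \<open>f\<close> exists is shown without Fourier transform.  By Cauchy's theorem the inner product of
  the slices of \<open>F\<close> at heights \<open>a\<close> and \<open>b\<close> is a function \<open>A(a + b)\<close> of the sum only.  Hence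
  \<open>\<parallel>F\<^sub>a - F\<^sub>b\<parallel>\<^sup>2 = A(2a) + A(2b) - 2 A(a + b)\<close>, so \<open>A\<close> is midpoint convex; being bounded it is
  decreasing, and therefore the slices are Cauchy in \<open>L\<^sup>2\<close> as the height tends to \<open>0\<close>.
\<close>

section \<open>Cauchy's theorem on the slices of a tube\<close>

text \<open>The inner product goes through \<open>boundary_fun\<close>, a \<open>SOME\<close>
  choice, so nothing can be said about it until an L2 limit of the slices is known to exist; this is
  the only point where holomorphy of F is used. For the kernels the choice is harmless once any two
  L2 limits of the same slices are shown to agree almost everywhere. The norm of the kernel is never
  computed: a lower bound of the right order in y, with a constant depending only on \<alpha>,
  suffices. The obstacle in the decay is that |y| -> infinity says little about single coordinates:
  one may grow while others tend to 0, where their factors of the kernel concentrate. Hence every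
  one-dimensional factor is normalised to have L2 norm at most sqrt pi for all heights, and a single
  large coordinate has to supply all the smallness. Uniformity in x then needs no extra argument,
  because every bound is either a translation invariant integral or a supremum times the length of a
  fixed interval.\<close>

lemma Cauchy_unit_square:
  assumes h: "\<And>w. 0 \<le> Im w \<Longrightarrow> Im w \<le> 1 \<Longrightarrow> h field_differentiable at w"
  shows "(\<integral>t. indicator {0..1} t *\<^sub>R h (of_real t) \<partial>lborel)
           + (\<integral>s. indicator {0..1} s *\<^sub>R (\<i> * h (1 + \<i> * of_real s)) \<partial>lborel)
       = (\<integral>s. indicator {0..1} s *\<^sub>R (\<i> * h (\<i> * of_real s)) \<partial>lborel)
           + (\<integral>t. indicator {0..1} t *\<^sub>R h (of_real t + \<i>) \<partial>lborel)"
proof -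
  define S where "S = {w. 0 \<le> Im w \<and> Im w \<le> 1}"
  have "convex S"
  proof -
    have "S = {w. 0 \<le> Im w} \<inter> {w. Im w \<le> 1}" by (auto simp: S_def)
    then show ?thesis by (simp add: convex_Int convex_halfspace_Im_ge convex_halfspace_Im_le)
  qed
  have contS: "continuous_on S h"
    using h by (intro continuous_at_imp_continuous_on) (auto simp: S_def field_differentiable_imp_continuous_at)
  obtain P where P: "\<And>w. w \<in> S \<Longrightarrow> (P has_field_derivative h w) (at w within S)"
    using holomorphic_convex_primitive[OF \<open>convex S\<close> finite.emptyI contS] h interior_subset[of S]
    by (auto simp: S_def)
  \<comment> \<open>Each side is a difference of values of the primitive at two corners, so both
    sides of the claim equal P(1 + i) - P(0). The primitive exists because the strip is
    convex.\<close>
  have edge: "(\<integral>t. indicator {0..1} t *\<^sub>R (e * h (p + e * of_real t)) \<partial>lborel) = P (p + e) - P p"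
    if e: "\<And>t::real. 0 \<le> t \<Longrightarrow> t \<le> 1 \<Longrightarrow> p + e * of_real t \<in> S" for p e
  proof -
    have "(\<integral>t. indicator {0..1} t *\<^sub>R (e * h (p + e * of_real t)) \<partial>lborel)
        = (P \<circ> (\<lambda>t. p + e * of_real t)) 1 - (P \<circ> (\<lambda>t. p + e * of_real t)) 0"
    proof (rule integral_FTC_Icc)
      fix t :: real assume t: "0 \<le> t" "t \<le> 1"
      show "((P \<circ> (\<lambda>t. p + e * of_real t)) has_vector_derivative e * h (p + e * of_real t)) (at t within {0..1})"
      proof (rule field_vector_diff_chain_within)
        show "((\<lambda>t. p + e * of_real t) has_vector_derivative e) (at t within {0..1})"
          by (auto intro!: derivative_eq_intros)
        show "(P has_field_derivative h (p + e * of_real t))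
            (at (p + e * of_real t) within (\<lambda>t. p + e * of_real t) ` {0..1})"
          using P[OF e[OF t]] by (rule DERIV_subset) (use e in auto)
      qed
    next
      show "continuous_on {0..1} (\<lambda>t. e * h (p + e * of_real t))"
        by (intro continuous_intros continuous_on_compose2[OF contS]) (use e in auto)
    qed auto
    then show ?thesis by simp
  qed
  show ?thesis
    using edge[of 0 1] edge[of 1 \<i>] edge[of 0 \<i>] edge[of \<i> 1]
    by (simp add: S_def add.commute)
qed

text \<open>Fubini for an edge integral that is afterwards integrated over its base point x. Joint
  measurability comes from continuity on the closed strip, absolute integrability from an L1 bound
  in x that is uniform in t. Integrability is recorded as well, so that the identity for the four
  edges can be integrated term by term.\<close>

lemma integral_swap_unit_interval:
  fixes u :: "'a::euclidean_space \<Rightarrow> real \<Rightarrow> complex"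
  assumes cont: "continuous_on (UNIV \<times> {0..1}) (case_prod u)"
    and bound: "\<And>t. 0 \<le> t \<Longrightarrow> t \<le> 1 \<Longrightarrow> (\<integral>\<^sup>+x. ennreal (cmod (u x t)) \<partial>lborel) \<le> ennreal M"
  shows "integrable lborel (\<lambda>x. \<integral>t. indicator {0..1} t *\<^sub>R u x t \<partial>lborel)"
    and "(\<integral>x. (\<integral>t. indicator {0..1} t *\<^sub>R u x t \<partial>lborel) \<partial>lborel)
       = (\<integral>t. indicator {0..1} t *\<^sub>R (\<integral>x. u x t \<partial>lborel) \<partial>lborel)"
proof -
  define v where "v = (\<lambda>x t. indicator {0..1} t *\<^sub>R u x t)"
  have "(\<lambda>z. indicator (UNIV \<times> {0..1}) z *\<^sub>R case_prod u z) \<in> borel_measurable borel"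
    by (rule borel_measurable_continuous_on_indicator[OF _ cont]) (auto intro!: borel_closed closed_Times)
  also have "(\<lambda>z. indicator (UNIV \<times> {0..1}) z *\<^sub>R case_prod u z) = case_prod v"
    by (auto simp: fun_eq_iff v_def indicator_def)
  finally have v[measurable]: "case_prod v \<in> borel_measurable (lborel \<Otimes>\<^sub>M lborel)"
    by (simp add: lborel_prod)
  have int: "integrable (lborel \<Otimes>\<^sub>M lborel) (case_prod v)"
  proof (rule integrableI_bounded)
    have "(\<integral>\<^sup>+z. ennreal (norm (case_prod v z)) \<partial>(lborel \<Otimes>\<^sub>M lborel))
        = (\<integral>\<^sup>+t. \<integral>\<^sup>+x. ennreal (norm (v x t)) \<partial>lborel \<partial>lborel)"
      using lborel_pair.Fubini[of "\<lambda>z. ennreal (norm (case_prod v z))"] lborel.nn_integral_fst[of "\<lambda>z. ennreal (norm (case_prod v z))" lborel]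
      by simp
    also have "\<dots> \<le> (\<integral>\<^sup>+t. ennreal M * indicator {0..1::real} t \<partial>lborel)"
      by (intro nn_integral_mono) (auto simp: v_def indicator_def bound)
    also have "\<dots> = ennreal M" by (simp add: nn_integral_cmult)
    also have "\<dots> < \<infinity>" by simp
    finally show "(\<integral>\<^sup>+z. ennreal (norm (case_prod v z)) \<partial>(lborel \<Otimes>\<^sub>M lborel)) < \<infinity>" .
  qed (rule v)
  show "integrable lborel (\<lambda>x. \<integral>t. indicator {0..1} t *\<^sub>R u x t \<partial>lborel)"
    using lborel_pair.integrable_fst[OF int] by (simp add: v_def)
  have "(\<integral>x. (\<integral>t. v x t \<partial>lborel) \<partial>lborel) = (\<integral>t. (\<integral>x. v x t \<partial>lborel) \<partial>lborel)"
    by (rule lborel_pair.Fubini_integral[OF int, symmetric])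
  then show "(\<integral>x. (\<integral>t. indicator {0..1} t *\<^sub>R u x t \<partial>lborel) \<partial>lborel)
       = (\<integral>t. indicator {0..1} t *\<^sub>R (\<integral>x. u x t \<partial>lborel) \<partial>lborel)"
    by (simp add: v_def)
qed

lemma lborel_integral_translation:
  fixes f :: "'a::euclidean_space \<Rightarrow> 'b::{banach, second_countable_topology}"
  assumes [measurable]: "f \<in> borel_measurable borel"
  shows "(\<integral>x. f (x + c) \<partial>lborel) = (\<integral>x. f x \<partial>lborel)"
proof -
  have "(\<integral>x. f x \<partial>lborel) = (\<integral>x. f x \<partial>distr lborel borel ((+) c))"
    by (simp add: lborel_distr_plus)
  also have "\<dots> = (\<integral>x. f (c + x) \<partial>lborel)" by (rule integral_distr) auto
  finally show ?thesis by (simp add: add.commute)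
qed

lemma lborel_nn_integral_translation:
  fixes f :: "'a::euclidean_space \<Rightarrow> ennreal"
  assumes [measurable]: "f \<in> borel_measurable borel"
  shows "(\<integral>\<^sup>+x. f (x + c) \<partial>lborel) = (\<integral>\<^sup>+x. f x \<partial>lborel)"
proof -
  have "(\<integral>\<^sup>+x. f x \<partial>lborel) = (\<integral>\<^sup>+x. f x \<partial>distr lborel borel ((+) c))"
    by (simp add: lborel_distr_plus)
  also have "\<dots> = (\<integral>\<^sup>+x. f (c + x) \<partial>lborel)" by (rule nn_integral_distr) auto
  finally show ?thesis by (simp add: add.commute)
qed

lemma cvec_nth [simp]: "cvec x y $ k = Complex (x $ k) (y $ k)"
  by (simp add: cvec_def Complex_eq)

lemma continuous_on_cvec [continuous_intros]:
  assumes "continuous_on S f" "continuous_on S g"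
  shows "continuous_on S (\<lambda>p. cvec (f p) (g p))"
  unfolding cvec_def using assms by (intro continuous_intros)

lemma holomorphic_several_continuous_on:
  assumes "holomorphic_several F S"
  shows "continuous_on S F"
  using assms unfolding holomorphic_several_def
  by (intro continuous_at_imp_continuous_on) (auto dest!: has_derivative_continuous)

lemma slice_borel_measurable:
  assumes "continuous_on (tube S) F" "a \<in> S"
  shows "(\<lambda>x. F (cvec x a)) \<in> borel_measurable borel"
  using assms
  by (intro borel_measurable_continuous_onI continuous_on_compose2[OF assms(1)] continuous_intros)
     (auto simp: tube_def)

text \<open>Since d is real, the point x + ia + wd is complex affine in w; a complex linear
  derivative composed with it is multiplication by the single number given by the sum of the
  \<open>c $ j * of_real (d $ j)\<close>.\<close>

lemma holomorphic_several_along_line: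
  assumes F: "holomorphic_several F S" and w: "cvec (x + Re w *\<^sub>R d) (a + Im w *\<^sub>R d) \<in> S"
  shows "(\<lambda>w. F (cvec (x + Re w *\<^sub>R d) (a + Im w *\<^sub>R d))) field_differentiable at w"
proof -
  obtain c where c: "(F has_derivative (\<lambda>h. \<Sum>j\<in>UNIV. c $ j * h $ j))
      (at (cvec (x + Re w *\<^sub>R d) (a + Im w *\<^sub>R d)))"
    using F w unfolding holomorphic_several_def by blast
  have line: "cvec (x + Re w *\<^sub>R d) (a + Im w *\<^sub>R d) = (\<chi> k. Complex (x $ k) (a $ k) + of_real (d $ k) * w)" for w
    by (simp add: vec_eq_iff complex_eq_iff)
  have "((\<lambda>w. \<chi> k. Complex (x $ k) (a $ k) + of_real (d $ k) * w) has_derivative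
      (\<lambda>h. \<chi> k. of_real (d $ k) * h)) (at w)"
    by (subst has_derivative_componentwise_within)
       (auto intro!: derivative_eq_intros simp: Basis_vec_def inner_axis)
  from diff_chain_at[OF this c[unfolded line]]
  have "((\<lambda>w. F (\<chi> k. Complex (x $ k) (a $ k) + of_real (d $ k) * w)) has_derivative
      (\<lambda>h. \<Sum>j\<in>UNIV. c $ j * (of_real (d $ j) * h))) (at w)"
    by (auto simp: o_def)
  also have "(\<lambda>h. \<Sum>j\<in>UNIV. c $ j * (of_real (d $ j) * h)) = (*) (\<Sum>j\<in>UNIV. c $ j * of_real (d $ j))"
    by (auto simp: fun_eq_iff sum_distrib_right mult.assoc)
  finally show ?thesis
    unfolding line field_differentiable_def has_field_derivative_def by blast
qed

text \<open>
  Averaging over translates by \<open>t d\<close>, \<open>0 \<le> t \<le> 1\<close>, turns the claim into Cauchy's theorem on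
  a unit square in the direction \<open>d = b - a\<close>: the two vertical sides are translates of each
  other, so their contributions cancel exactly and no decay at infinity is needed.
\<close>

proposition slice_integral_invariant:
  fixes H :: "complex ^ 'n \<Rightarrow> complex"
  assumes hol: "holomorphic_several H (tube S)" and "convex S" and a: "a \<in> S" and b: "b \<in> S"
    and bound: "\<And>y. y \<in> S \<Longrightarrow> (\<integral>\<^sup>+x. ennreal (cmod (H (cvec x y))) \<partial>lborel) \<le> ennreal M"
  shows "(\<integral>x. H (cvec x a) \<partial>lborel) = (\<integral>x. H (cvec x b) \<partial>lborel)"
proof -
  define d where "d = b - a"
  have seg: "a + s *\<^sub>R d \<in> S" if "0 \<le> s" "s \<le> 1" for s
    using convexD_alt[OF \<open>convex S\<close> a b that] by (simp add: d_def algebra_simps)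
  have contH: "continuous_on (tube S) H" by (rule holomorphic_several_continuous_on[OF hol])
  \<comment> \<open>\<open>h x\<close> is H on the complex line through x + ia in direction d: w = 0
    lies over height a and w = \<i> over height b, while a real shift of w only translates
    x.\<close>
  define h where "h = (\<lambda>x w. H (cvec (x + Re w *\<^sub>R d) (a + Im w *\<^sub>R d)))"
  have h_int: "(\<integral>x. h x w \<partial>lborel) = (\<integral>x. H (cvec x (a + Im w *\<^sub>R d)) \<partial>lborel)"
    and h_bound: "(\<integral>\<^sup>+x. ennreal (cmod (h x w)) \<partial>lborel) \<le> ennreal M"
    if "0 \<le> Im w" "Im w \<le> 1" for w
  proof -
    have m[measurable]: "(\<lambda>x. H (cvec x (a + Im w *\<^sub>R d))) \<in> borel_measurable borel"
      by (rule slice_borel_measurable[OF contH seg[OF that]])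
    show "(\<integral>x. h x w \<partial>lborel) = (\<integral>x. H (cvec x (a + Im w *\<^sub>R d)) \<partial>lborel)"
      unfolding h_def by (rule lborel_integral_translation[OF m])
    have "(\<integral>\<^sup>+x. ennreal (cmod (h x w)) \<partial>lborel)
        = (\<integral>\<^sup>+x. ennreal (cmod (H (cvec x (a + Im w *\<^sub>R d)))) \<partial>lborel)"
      unfolding h_def by (rule lborel_nn_integral_translation) measurable
    then show "(\<integral>\<^sup>+x. ennreal (cmod (h x w)) \<partial>lborel) \<le> ennreal M"
      using bound[OF seg[OF that]] by simp
  qed
  have h_cont: "continuous_on (UNIV \<times> {0..1}) (\<lambda>(x, t). h x (p + e * of_real t))"
    if "\<And>t::real. 0 \<le> t \<Longrightarrow> t \<le> 1 \<Longrightarrow> 0 \<le> Im (p + e * of_real t) \<and> Im (p + e * of_real t) \<le> 1" for p e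
    unfolding h_def case_prod_unfold
    by (intro continuous_on_compose2[OF contH] continuous_intros)
       (use that seg in \<open>fastforce simp: tube_def\<close>)
  \<comment> \<open>\<open>E p e x\<close> is the contour integral of \<open>h x\<close> along the
    edge from p to p + e; the four pairs (p, e) used below are the sides of the unit square.\<close>
  define E where "E = (\<lambda>p e x. \<integral>t. indicator {0..1} t *\<^sub>R (e * h x (p + e * of_real t)) \<partial>lborel)"
  have E: "integrable lborel (E p e)"
      "(\<integral>x. E p e x \<partial>lborel) =
        (\<integral>t. indicator {0..1} t *\<^sub>R (e * (\<integral>x. H (cvec x (a + Im (p + e * of_real t) *\<^sub>R d)) \<partial>lborel)) \<partial>lborel)"
    if pe: "\<And>t::real. 0 \<le> t \<Longrightarrow> t \<le> 1 \<Longrightarrow> 0 \<le> Im (p + e * of_real t) \<and> Im (p + e * of_real t) \<le> 1"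
      and e: "cmod e = 1" for p e
  proof -
    have c: "continuous_on (UNIV \<times> {0..1}) (\<lambda>(x, t). e * h x (p + e * of_real t))"
      using h_cont[OF pe] unfolding case_prod_unfold by (intro continuous_intros) auto
    have b: "(\<integral>\<^sup>+x. ennreal (cmod (e * h x (p + e * of_real t))) \<partial>lborel) \<le> ennreal M"
      if "0 \<le> t" "t \<le> 1" for t
      using h_bound[of "p + e * of_real t"] pe[OF that] by (simp add: norm_mult e)
    show "integrable lborel (E p e)"
      unfolding E_def by (rule integral_swap_unit_interval(1)[OF c b])
    have "(\<integral>x. E p e x \<partial>lborel) = (\<integral>t. indicator {0..1} t *\<^sub>R (\<integral>x. e * h x (p + e * of_real t) \<partial>lborel) \<partial>lborel)"
      unfolding E_def by (rule integral_swap_unit_interval(2)[OF c b])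
    also have "\<dots> = (\<integral>t. indicator {0..1} t *\<^sub>R (e * (\<integral>x. H (cvec x (a + Im (p + e * of_real t) *\<^sub>R d)) \<partial>lborel)) \<partial>lborel)"
      by (intro Bochner_Integration.integral_cong) (use h_int pe in \<open>auto simp: indicator_def\<close>)
    finally show "(\<integral>x. E p e x \<partial>lborel) = \<dots>" .
  qed
  have sq: "E 0 1 x + E 1 \<i> x = E 0 \<i> x + E \<i> 1 x" for x
  proof -
    have "h x field_differentiable at w" if "0 \<le> Im w" "Im w \<le> 1" for w
      unfolding h_def using seg[OF that] by (intro holomorphic_several_along_line[OF hol]) (auto simp: tube_def)
    from Cauchy_unit_square[of "h x", OF this] show ?thesis by (simp add: E_def add.commute)
  qed
  have "(\<integral>x. E 0 1 x \<partial>lborel) + (\<integral>x. E 1 \<i> x \<partial>lborel) = (\<integral>x. E 0 \<i> x \<partial>lborel) + (\<integral>x. E \<i> 1 x \<partial>lborel)"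
    by (subst (1 2) Bochner_Integration.integral_add[symmetric]) (auto intro!: E(1) simp: sq)
  moreover have "(\<integral>x. E 1 \<i> x \<partial>lborel) = (\<integral>x. E 0 \<i> x \<partial>lborel)"
    by (subst (1 2) E(2)) auto
  ultimately have "(\<integral>x. E 0 1 x \<partial>lborel) = (\<integral>x. E \<i> 1 x \<partial>lborel)" by simp
  \<comment> \<open>On a horizontal edge the height is constant, so averaging over t leaves the
    slice integral unchanged.\<close>
  moreover have "(\<integral>x. E 0 1 x \<partial>lborel) = (\<integral>x. H (cvec x a) \<partial>lborel)"
    by (subst E(2)) auto
  moreover have "(\<integral>x. E \<i> 1 x \<partial>lborel) = (\<integral>x. H (cvec x b) \<partial>lborel)"
    by (subst E(2)) (auto simp: d_def)
  ultimately show ?thesis by simp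
qed

section \<open>Energy of the slices of a Hardy space function\<close>

lemma tube_cvec: "cvec x y \<in> tube S \<longleftrightarrow> y \<in> S"
proof -
  have "cvec x y = cvec x' y' \<longleftrightarrow> x = x' \<and> y = y'" for x' y'
    by (auto simp: vec_eq_iff)
  then show ?thesis by (auto simp: tube_def)
qed

lemma hardy_space_slice_bound:
  assumes "F \<in> hardy_space" "a \<in> octant"
  shows "(\<integral>\<^sup>+x. ennreal ((cmod (F (cvec x a)))\<^sup>2) \<partial>lborel) \<le> ennreal (enn2real (hardy_norm_sq F))"
proof -
  have "(\<integral>\<^sup>+x. ennreal ((cmod (F (cvec x a)))\<^sup>2) \<partial>lborel) \<le> hardy_norm_sq F"
    unfolding hardy_norm_sq_def by (rule SUP_upper[OF assms(2)])
  then show ?thesis using assms(1) by (simp add: hardy_space_def)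
qed

lemma hardy_space_slice_measurable:
  assumes "F \<in> hardy_space" "a \<in> octant"
  shows "(\<lambda>x. F (cvec x a)) \<in> borel_measurable borel"
  using assms
  by (intro slice_borel_measurable[where S = octant] holomorphic_several_continuous_on) (auto simp: hardy_space_def)

lemma norm_mult_le_sum_squares: "cmod (u * cnj v) \<le> (cmod u)\<^sup>2 + (cmod v)\<^sup>2"
proof -
  have "2 * (cmod u * cmod v) \<le> (cmod u)\<^sup>2 + (cmod v)\<^sup>2"
    using sum_squares_bound[of "cmod u" "cmod v"] by simp
  moreover have "0 \<le> cmod u * cmod v" by simp
  ultimately show ?thesis unfolding norm_mult complex_mod_cnj by linarith
qed

lemma octant_add: "a \<in> octant \<Longrightarrow> (\<And>k. 0 \<le> d $ k) \<Longrightarrow> a + d \<in> octant"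
  by (auto simp: octant_def add_pos_nonneg)

text \<open>
  \<open>F(z) cnj (F (cnj z + i c))\<close> is holomorphic and integrable on the slices over the box
  \<open>0 < y < c\<close>, so its integral over a slice does not depend on the slice.
\<close>

lemma hardy_slice_correlation:
  assumes F: "F \<in> hardy_space" and oct: "a \<in> octant" "b \<in> octant" "a' \<in> octant" "b' \<in> octant"
    and eq: "a + b = a' + b'"
  shows "(\<integral>x. F (cvec x a) * cnj (F (cvec x b)) \<partial>lborel)
       = (\<integral>x. F (cvec x a') * cnj (F (cvec x b')) \<partial>lborel)"
proof -
  define c where "c = a + b"
  define S where "S = {y. (\<forall>k. 0 < y $ k \<and> y $ k < c $ k)}"
  \<comment> \<open>An antiholomorphic reflection that keeps x and sends height y to c - y. The
    conjugation in H restores holomorphy, and on the slice at a the values of H are the integrand of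
    the correlation with c - a = b.\<close>
  define \<sigma> where "\<sigma> = (\<lambda>z :: complex ^ 'a. \<chi> k. cnj (z $ k) + \<i> * of_real (c $ k))"
  define H where "H = (\<lambda>z. F z * cnj (F (\<sigma> z)))"
  define M where "M = enn2real (hardy_norm_sq F)"
  have \<sigma>: "\<sigma> (cvec x y) = cvec x (c - y)" for x y
    by (simp add: \<sigma>_def vec_eq_iff complex_eq_iff)
  have S_oct: "y \<in> octant" "c - y \<in> octant" if "y \<in> S" for y
    using that by (auto simp: S_def octant_def)
  have holF: "holomorphic_several F (tube octant)" using F by (simp add: hardy_space_def)
  have "convex S"
  proof -
    have "S = box 0 c" by (auto simp: S_def mem_box_cart)
    then show ?thesis by simp
  qed
  moreover have "holomorphic_several H (tube S)"
    unfolding holomorphic_several_def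
  proof
    fix z assume "z \<in> tube S"
    then obtain x y where z: "z = cvec x y" and y: "y \<in> S" by (auto simp: tube_def)
    have zt: "z \<in> tube octant" "\<sigma> z \<in> tube octant"
      using S_oct[OF y] by (auto simp: z \<sigma> tube_cvec)
    from zt holF obtain p q where
      p: "(F has_derivative (\<lambda>h. \<Sum>j\<in>UNIV. p $ j * h $ j)) (at z)" and
      q: "(F has_derivative (\<lambda>h. \<Sum>j\<in>UNIV. q $ j * h $ j)) (at (\<sigma> z))"
      unfolding holomorphic_several_def by meson
    have "(\<sigma> has_derivative (\<lambda>h. \<chi> k. cnj (h $ k))) (at z)"
      unfolding \<sigma>_def
      by (subst has_derivative_componentwise_within)
         (auto intro!: derivative_eq_intros bounded_linear_imp_has_derivative[OF bounded_linear_vec_nth]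
            simp: Basis_vec_def inner_axis)
    from diff_chain_at[OF this q]
    have "((\<lambda>z. F (\<sigma> z)) has_derivative (\<lambda>h. \<Sum>j\<in>UNIV. q $ j * cnj (h $ j))) (at z)"
      by (simp add: o_def)
    from has_derivative_mult[OF p has_derivative_cnj[OF this]]
    have "(H has_derivative (\<lambda>h. F z * cnj (\<Sum>j\<in>UNIV. q $ j * cnj (h $ j)) +
        (\<Sum>j\<in>UNIV. p $ j * h $ j) * cnj (F (\<sigma> z)))) (at z)"
      by (simp add: H_def)
    also have "(\<lambda>h. F z * cnj (\<Sum>j\<in>UNIV. q $ j * cnj (h $ j)) +
        (\<Sum>j\<in>UNIV. p $ j * h $ j) * cnj (F (\<sigma> z)))
      = (\<lambda>h. \<Sum>j\<in>UNIV. (\<chi> j. F z * cnj (q $ j) + p $ j * cnj (F (\<sigma> z))) $ j * h $ j)"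
      by (auto simp: fun_eq_iff sum_distrib_left sum_distrib_right sum.distrib algebra_simps)
    finally show "\<exists>a. (H has_derivative (\<lambda>h. \<Sum>j\<in>UNIV. a $ j * h $ j)) (at z)" by blast
  qed
  moreover have "(\<integral>\<^sup>+x. ennreal (cmod (H (cvec x y))) \<partial>lborel) \<le> ennreal (M + M)" if y: "y \<in> S" for y
  proof -
    note [measurable] = hardy_space_slice_measurable[OF F S_oct(1)[OF y]]
      hardy_space_slice_measurable[OF F S_oct(2)[OF y]]
    have "(\<integral>\<^sup>+x. ennreal (cmod (H (cvec x y))) \<partial>lborel)
        \<le> (\<integral>\<^sup>+x. ennreal ((cmod (F (cvec x y)))\<^sup>2) + ennreal ((cmod (F (cvec x (c - y))))\<^sup>2) \<partial>lborel)"
      by (intro nn_integral_mono)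
         (simp add: H_def \<sigma> norm_mult_le_sum_squares flip: ennreal_plus)
    also have "\<dots> = (\<integral>\<^sup>+x. ennreal ((cmod (F (cvec x y)))\<^sup>2) \<partial>lborel)
        + (\<integral>\<^sup>+x. ennreal ((cmod (F (cvec x (c - y))))\<^sup>2) \<partial>lborel)"
      by (rule nn_integral_add) measurable
    also have "\<dots> \<le> ennreal M + ennreal M"
      unfolding M_def by (intro add_mono hardy_space_slice_bound F S_oct y)
    also have "\<dots> = ennreal (M + M)" by (simp add: M_def flip: ennreal_plus)
    finally show ?thesis .
  qed
  moreover have "a \<in> S" "a' \<in> S"
  proof -
    have "c $ k = a $ k + b $ k" "c $ k = a' $ k + b' $ k" for k
      using eq by (simp_all add: c_def flip: vector_add_component)
    moreover have "0 < a $ k" "0 < b $ k" "0 < a' $ k" "0 < b' $ k" for k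
      using oct by (auto simp: octant_def)
    ultimately show "a \<in> S" "a' \<in> S"
      unfolding S_def by (smt (verit) mem_Collect_eq)+
  qed
  ultimately have "(\<integral>x. H (cvec x a) \<partial>lborel) = (\<integral>x. H (cvec x a') \<partial>lborel)"
    by (intro slice_integral_invariant[of H S])
  moreover have "c - a = b" by (simp add: c_def)
  moreover have "c - a' = b'" by (simp add: c_def eq)
  ultimately show ?thesis by (simp add: H_def \<sigma>)
qed

text \<open>This is A(2a) in the notation of the overview. It is indexed by the slice instead of the
  sum of heights, so A(a + b) becomes the energy at the midpoint of a and b.\<close>

definition slice_energy :: "(complex ^ 'n \<Rightarrow> complex) \<Rightarrow> real ^ 'n \<Rightarrow> real" where
  "slice_energy F a = (\<integral>x. (cmod (F (cvec x a)))\<^sup>2 \<partial>lborel)"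

lemma hardy_space_slice_integrable:
  assumes "F \<in> hardy_space" "a \<in> octant"
  shows "integrable lborel (\<lambda>x. (cmod (F (cvec x a)))\<^sup>2)"
proof (rule integrableI_bounded)
  show "(\<lambda>x. (cmod (F (cvec x a)))\<^sup>2) \<in> borel_measurable lborel"
    using hardy_space_slice_measurable[OF assms] by simp
  show "(\<integral>\<^sup>+x. ennreal (norm ((cmod (F (cvec x a)))\<^sup>2)) \<partial>lborel) < \<infinity>"
    using hardy_space_slice_bound[OF assms] by (simp add: le_less_trans)
qed

lemma slice_energy_le:
  assumes "F \<in> hardy_space" "a \<in> octant"
  shows "slice_energy F a \<le> enn2real (hardy_norm_sq F)"
proof -
  have "ennreal (slice_energy F a) = (\<integral>\<^sup>+x. ennreal ((cmod (F (cvec x a)))\<^sup>2) \<partial>lborel)"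
    unfolding slice_energy_def
    by (rule nn_integral_eq_integral[symmetric]) (auto intro: hardy_space_slice_integrable[OF assms])
  with hardy_space_slice_bound[OF assms] show ?thesis by (metis ennreal_le_iff enn2real_nonneg)
qed

text \<open>Expanding the square leaves the correlation of the slices at a and b, which equals that
  of the midpoint slice with itself. Midpoint convexity is the nonnegativity of this expression; it
  is stated separately because \<open>ennreal\<close> truncates negative numbers to 0 and would hide
  it.\<close>

lemma slice_distance:
  assumes F: "F \<in> hardy_space" and a: "a \<in> octant" and b: "b \<in> octant"
  shows "(\<integral>\<^sup>+x. ennreal ((cmod (F (cvec x a) - F (cvec x b)))\<^sup>2) \<partial>lborel)
       = ennreal (slice_energy F a + slice_energy F b - 2 * slice_energy F ((1/2) *\<^sub>R (a + b)))"
    and "2 * slice_energy F ((1/2) *\<^sub>R (a + b)) \<le> slice_energy F a + slice_energy F b"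
proof -
  define m where "m = (1/2) *\<^sub>R (a + b)"
  have m: "m \<in> octant" using a b by (auto simp: m_def octant_def add_pos_pos)
  note int = hardy_space_slice_integrable[OF F a] hardy_space_slice_integrable[OF F b]
  note [measurable] = hardy_space_slice_measurable[OF F a] hardy_space_slice_measurable[OF F b]
  have meas_ab: "(\<lambda>x. F (cvec x a) * cnj (F (cvec x b))) \<in> borel_measurable lborel"
    by (intro borel_measurable_times borel_measurable_continuous_on[of cnj] continuous_intros) auto
  have int_ab: "integrable lborel (\<lambda>x. F (cvec x a) * cnj (F (cvec x b)))"
    by (rule Bochner_Integration.integrable_bound[OF Bochner_Integration.integrable_add[OF int]])
       (use meas_ab in \<open>auto simp: norm_mult_le_sum_squares\<close>)
  have "(\<integral>x. F (cvec x a) * cnj (F (cvec x b)) \<partial>lborel) = (\<integral>x. F (cvec x m) * cnj (F (cvec x m)) \<partial>lborel)"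
    by (rule hardy_slice_correlation[OF F a b m m]) (simp add: m_def vec_eq_iff)
  also have "\<dots> = of_real (slice_energy F m)"
    unfolding slice_energy_def integral_complex_of_real[symmetric] complex_norm_square ..
  finally have corr: "(\<integral>x. F (cvec x a) * cnj (F (cvec x b)) \<partial>lborel) = of_real (slice_energy F m)" .
  have expand: "(cmod (u - v))\<^sup>2 = (cmod u)\<^sup>2 + (cmod v)\<^sup>2 - 2 * Re (u * cnj v)" for u v
    by (simp add: cmod_power2 power2_diff algebra_simps)
  have "integrable lborel (\<lambda>x. (cmod (F (cvec x a) - F (cvec x b)))\<^sup>2)"
    unfolding expand using int int_ab by (intro Bochner_Integration.integrable_diff Bochner_Integration.integrable_add integrable_mult_right integrable_Re) auto
  then have nn: "(\<integral>\<^sup>+x. ennreal ((cmod (F (cvec x a) - F (cvec x b)))\<^sup>2) \<partial>lborel)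
      = ennreal (\<integral>x. (cmod (F (cvec x a) - F (cvec x b)))\<^sup>2 \<partial>lborel)"
    by (rule nn_integral_eq_integral) auto
  have eq: "(\<integral>x. (cmod (F (cvec x a) - F (cvec x b)))\<^sup>2 \<partial>lborel)
      = slice_energy F a + slice_energy F b - 2 * slice_energy F m"
  proof -
    have "(\<integral>x. Re (F (cvec x a) * cnj (F (cvec x b))) \<partial>lborel) = slice_energy F m"
      unfolding integral_Re[OF int_ab] corr by simp
    then show ?thesis
      unfolding expand using int int_ab
      by (simp add: slice_energy_def Bochner_Integration.integral_diff Bochner_Integration.integral_add
          integrable_Re del: times_complex.sel)
  qed
  show "(\<integral>\<^sup>+x. ennreal ((cmod (F (cvec x a) - F (cvec x b)))\<^sup>2) \<partial>lborel)
       = ennreal (slice_energy F a + slice_energy F b - 2 * slice_energy F ((1/2) *\<^sub>R (a + b)))"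
    unfolding nn eq m_def ..
  have "0 \<le> (\<integral>x. (cmod (F (cvec x a) - F (cvec x b)))\<^sup>2 \<partial>lborel)" by simp
  then show "2 * slice_energy F ((1/2) *\<^sub>R (a + b)) \<le> slice_energy F a + slice_energy F b"
    unfolding eq m_def by linarith
qed

text \<open>The increments of a convex sequence do not decrease, so a positive first increment would
  force linear growth.\<close>

lemma convex_bounded_seq_first_step:
  fixes u :: "nat \<Rightarrow> real"
  assumes conv: "\<And>k. 2 * u (Suc k) \<le> u k + u (Suc (Suc k))" and bd: "\<And>k. u k \<le> M"
  shows "u 1 \<le> u 0"
proof (rule ccontr)
  assume "\<not> u 1 \<le> u 0"
  then have pos: "u 1 - u 0 > 0" by simp
  have step: "u (Suc k) - u k \<ge> u 1 - u 0" for k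
  proof (induction k)
    case (Suc k)
    then show ?case using conv[of k] by linarith
  qed simp
  have lin: "u k \<ge> u 0 + real k * (u 1 - u 0)" for k
  proof (induction k)
    case (Suc k)
    then show ?case using step[of k] by (simp add: algebra_simps)
  qed simp
  obtain k :: nat where "real k * (u 1 - u 0) > M - u 0"
    using reals_Archimedean3[OF pos] by blast
  then show False using lin[of k] bd[of k] by simp
qed

text \<open>The ray from a through b never leaves the octant, as its direction has nonnegative
  coordinates. Along it the energies form a convex bounded sequence.\<close>

lemma slice_energy_antimono:
  assumes F: "F \<in> hardy_space" and a: "a \<in> octant" and le: "\<And>k. a $ k \<le> b $ k"
  shows "slice_energy F b \<le> slice_energy F a"
proof -
  define d where "d = b - a"
  define u where "u k = slice_energy F (a + real k *\<^sub>R d)" for k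
  have oct: "a + real k *\<^sub>R d \<in> octant" for k
    using a le by (intro octant_add) (auto simp: d_def)
  have "u 1 \<le> u 0"
  proof (rule convex_bounded_seq_first_step)
    fix k
    have "(1/2) *\<^sub>R ((a + real k *\<^sub>R d) + (a + real (Suc (Suc k)) *\<^sub>R d)) = a + real (Suc k) *\<^sub>R d"
    proof -
      have "(1/2) *\<^sub>R ((a + real k *\<^sub>R d) + (a + real (Suc (Suc k)) *\<^sub>R d))
          = (1/2) *\<^sub>R (2 *\<^sub>R (a + real (Suc k) *\<^sub>R d))"
        by (simp add: vec_eq_iff algebra_simps)
      then show ?thesis by simp
    qed
    then show "2 * u (Suc k) \<le> u k + u (Suc (Suc k))"
      using slice_distance(2)[OF F oct[of k] oct[of "Suc (Suc k)"]] by (simp only: u_def)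
    show "u k \<le> enn2real (hardy_norm_sq F)"
      unfolding u_def by (rule slice_energy_le[OF F oct])
  qed
  then show ?thesis by (simp add: u_def d_def)
qed

text \<open>Choose c with energy within \<epsilon>/2 of the supremum s. If a and b lie below c, so
  does their midpoint, whose energy then exceeds s - \<epsilon>/2, while those of a and b are at
  most s; the distance formula gives \<epsilon>.\<close>

lemma slices_Cauchy_at_0:
  assumes F: "F \<in> hardy_space" and "\<epsilon> > 0"
  shows "\<exists>\<delta>>0. \<forall>a\<in>octant. \<forall>b\<in>octant. norm a < \<delta> \<longrightarrow> norm b < \<delta> \<longrightarrow>
    (\<integral>\<^sup>+x. ennreal ((cmod (F (cvec x a) - F (cvec x b)))\<^sup>2) \<partial>lborel) \<le> ennreal \<epsilon>"
proof -
  have ne: "(1 :: real ^ 'a) \<in> octant" by (simp add: octant_def)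
  have bdd: "bdd_above (slice_energy F ` octant)"
    using slice_energy_le[OF F] by (intro bdd_aboveI2) auto
  define s where "s = (SUP a\<in>octant. slice_energy F a)"
  have "s - \<epsilon> / 2 < s" using \<open>\<epsilon> > 0\<close> by simp
  then obtain c where c: "c \<in> octant" "s - \<epsilon> / 2 < slice_energy F c"
    unfolding s_def using less_cSUP_iff[OF _ bdd] ne by blast
  \<comment> \<open>The smallest coordinate of c: a vector of smaller norm lies below c in every
    coordinate.\<close>
  define \<delta> where "\<delta> = Min (range (\<lambda>k. c $ k))"
  have \<delta>: "\<delta> > 0" "\<And>k. \<delta> \<le> c $ k"
    using c by (auto simp: \<delta>_def octant_def)
  show ?thesis
  proof (intro exI[of _ \<delta>] conjI ballI impI \<delta>)
    fix a b :: "real ^ 'a" assume ab: "a \<in> octant" "b \<in> octant" "norm a < \<delta>" "norm b < \<delta>"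
    have lt: "a $ k < c $ k" "b $ k < c $ k" for k
      using component_le_norm_cart[of a k] component_le_norm_cart[of b k] ab \<delta>(2)[of k] by auto
    define m where "m = (1/2) *\<^sub>R (a + b)"
    have m: "m \<in> octant" using ab by (auto simp: m_def octant_def add_pos_pos)
    have "m $ k \<le> c $ k" for k using lt[of k] by (simp add: m_def)
    then have "slice_energy F c \<le> slice_energy F m" by (rule slice_energy_antimono[OF F m])
    moreover have "slice_energy F a \<le> s" "slice_energy F b \<le> s"
      unfolding s_def using ab by (auto intro!: cSUP_upper bdd)
    ultimately have "slice_energy F a + slice_energy F b - 2 * slice_energy F m \<le> \<epsilon>"
      using c(2) by linarith
    then show "(\<integral>\<^sup>+x. ennreal ((cmod (F (cvec x a) - F (cvec x b)))\<^sup>2) \<partial>lborel) \<le> ennreal \<epsilon>"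
      using slice_distance(1)[OF F ab(1,2)] unfolding m_def by (metis ennreal_leI)
  qed
qed

section \<open>Boundary functions\<close>

lemma norm_diff_squared_le: "(norm (u - v))\<^sup>2 \<le> 2 * (norm u)\<^sup>2 + 2 * (norm (v :: 'a::real_normed_vector))\<^sup>2"
proof -
  have "(norm (u - v))\<^sup>2 \<le> (norm u + norm v)\<^sup>2"
    by (intro power_mono norm_triangle_ineq4) auto
  also have "\<dots> \<le> 2 * (norm u)\<^sup>2 + 2 * (norm v)\<^sup>2"
    using sum_squares_bound[of "norm u" "norm v"] by (simp add: power2_sum)
  finally show ?thesis .
qed

lemma nn_integral_norm_diff_squared_le:
  fixes u v :: "'a \<Rightarrow> 'b::{real_normed_vector, second_countable_topology}"
  assumes [measurable]: "u \<in> borel_measurable M" "v \<in> borel_measurable M"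
  shows "(\<integral>\<^sup>+x. ennreal ((norm (u x - v x))\<^sup>2) \<partial>M)
     \<le> 2 * (\<integral>\<^sup>+x. ennreal ((norm (u x))\<^sup>2) \<partial>M) + 2 * (\<integral>\<^sup>+x. ennreal ((norm (v x))\<^sup>2) \<partial>M)"
proof -
  have "(\<integral>\<^sup>+x. ennreal ((norm (u x - v x))\<^sup>2) \<partial>M)
      \<le> (\<integral>\<^sup>+x. 2 * ennreal ((norm (u x))\<^sup>2) + 2 * ennreal ((norm (v x))\<^sup>2) \<partial>M)"
  proof (rule nn_integral_mono)
    fix x
    have "ennreal ((norm (u x - v x))\<^sup>2) \<le> ennreal (2 * (norm (u x))\<^sup>2 + 2 * (norm (v x))\<^sup>2)"
      by (intro ennreal_leI norm_diff_squared_le)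
    then show "ennreal ((norm (u x - v x))\<^sup>2) \<le> 2 * ennreal ((norm (u x))\<^sup>2) + 2 * ennreal ((norm (v x))\<^sup>2)"
      by (simp add: ennreal_mult)
  qed
  also have "\<dots> = 2 * (\<integral>\<^sup>+x. ennreal ((norm (u x))\<^sup>2) \<partial>M) + 2 * (\<integral>\<^sup>+x. ennreal ((norm (v x))\<^sup>2) \<partial>M)"
    by (simp add: nn_integral_add nn_integral_cmult)
  finally show ?thesis .
qed

text \<open>Weighting the squared increments by 2^k keeps the sum of their integrals finite, so
  almost everywhere they are at most C / 2^k. The increments themselves are then dominated by a
  geometric series of ratio 1 / sqrt 2.\<close>

lemma AE_convergent_if_rapidly_L2_Cauchy:
  fixes f :: "nat \<Rightarrow> 'a \<Rightarrow> complex"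
  assumes [measurable]: "\<And>k. f k \<in> borel_measurable M"
    and rapid: "\<And>k. (\<integral>\<^sup>+x. ennreal ((cmod (f (Suc k) x - f k x))\<^sup>2) \<partial>M) \<le> ennreal ((1/4) ^ k)"
  shows "AE x in M. convergent (\<lambda>k. f k x)"
proof -
  have "(\<integral>\<^sup>+x. (\<Sum>k. ennreal (2 ^ k * (cmod (f (Suc k) x - f k x))\<^sup>2)) \<partial>M)
      = (\<Sum>k. \<integral>\<^sup>+x. ennreal (2 ^ k * (cmod (f (Suc k) x - f k x))\<^sup>2) \<partial>M)"
    by (rule nn_integral_suminf) measurable
  also have "\<dots> \<le> (\<Sum>k. ennreal ((1/2) ^ k))"
  proof (rule suminf_le)
    fix k
    have "(\<integral>\<^sup>+x. ennreal (2 ^ k * (cmod (f (Suc k) x - f k x))\<^sup>2) \<partial>M)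
        = ennreal (2 ^ k) * (\<integral>\<^sup>+x. ennreal ((cmod (f (Suc k) x - f k x))\<^sup>2) \<partial>M)"
      by (subst nn_integral_cmult[symmetric]) (auto simp: ennreal_mult)
    also have "\<dots> \<le> ennreal (2 ^ k) * ennreal ((1/4) ^ k)"
      by (intro mult_left_mono rapid) auto
    also have "\<dots> = ennreal ((1/2) ^ k)"
      by (simp add: ennreal_mult[symmetric] power_mult_distrib[symmetric])
    finally show "(\<integral>\<^sup>+x. ennreal (2 ^ k * (cmod (f (Suc k) x - f k x))\<^sup>2) \<partial>M) \<le> ennreal ((1/2) ^ k)" .
  qed auto
  also have "\<dots> = ennreal (\<Sum>k. (1/2) ^ k)"
    by (rule suminf_ennreal2) (auto intro: summable_geometric)
  finally have "(\<integral>\<^sup>+x. (\<Sum>k. ennreal (2 ^ k * (cmod (f (Suc k) x - f k x))\<^sup>2)) \<partial>M) \<noteq> \<infinity>"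
    by (auto simp: top_unique)
  then have "AE x in M. (\<Sum>k. ennreal (2 ^ k * (cmod (f (Suc k) x - f k x))\<^sup>2)) \<noteq> \<infinity>"
    by (intro nn_integral_PInf_AE) measurable
  then show ?thesis
  proof eventually_elim
    case (elim x)
    define d where "d k = f (Suc k) x - f k x" for k
    define e where "e k = ennreal (2 ^ k * (cmod (d k))\<^sup>2)" for k
    define C where "C = enn2real (suminf e)"
    have "e = (\<lambda>k. ennreal (2 ^ k * (cmod (f (Suc k) x - f k x))\<^sup>2))"
      by (rule ext) (simp only: e_def d_def)
    with elim have fin: "suminf e < top" by (simp only: infinity_ennreal_def less_top)
    have le: "2 ^ k * (cmod (d k))\<^sup>2 \<le> C" for k
    proof -
      have "sum e {k} \<le> suminf e" by (rule sum_le_suminf) auto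
      also have "\<dots> = ennreal C" using fin by (simp add: C_def)
      finally have "e k \<le> ennreal C" by simp
      then show ?thesis unfolding e_def by (subst (asm) ennreal_le_iff) (auto simp: C_def)
    qed
    have d_le: "cmod (d k) \<le> sqrt C * (1 / sqrt 2) ^ k" for k
    proof -
      have "(cmod (d k))\<^sup>2 \<le> C / 2 ^ k" using le[of k] by (simp add: pos_le_divide_eq mult.commute)
      then have "cmod (d k) \<le> sqrt (C / 2 ^ k)" by (rule real_le_rsqrt)
      then show ?thesis unfolding real_sqrt_divide real_sqrt_power power_divide by simp
    qed
    have "summable (\<lambda>k. sqrt C * (1 / sqrt 2) ^ k)"
      by (intro summable_mult summable_geometric) simp
    then have "summable d"
      by (rule summable_comparison_test'[of _ 0]) (rule d_le)
    then have "convergent (\<lambda>n. f 0 x + (\<Sum>k<n. d k))"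
      by (intro convergent_add convergent_const) (simp add: summable_iff_convergent)
    moreover have "f 0 x + (\<Sum>k<n. d k) = f n x" for n
      using sum_lessThan_telescope[of "\<lambda>k. f k x" n] by (simp add: d_def)
    ultimately show ?case by (simp only:)
  qed
qed

lemma octant_arbitrarily_small:
  assumes "r > 0"
  shows "\<exists>a\<in>(octant :: (real ^ 'n) set). norm a < r"
proof
  define v :: "real ^ 'n" where "v = (\<chi> k. 1)"
  have "v \<noteq> 0" by (simp add: v_def vec_eq_iff)
  then show "norm ((r / 2 / norm v) *\<^sub>R v) < r" using assms by simp
  show "(r / 2 / norm v) *\<^sub>R v \<in> octant"
    using assms \<open>v \<noteq> 0\<close> by (auto simp: octant_def v_def)
qed

lemma at_0_within_octant_neq_bot: "at (0 :: real ^ 'n) within octant \<noteq> bot"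
proof -
  have "0 islimpt (octant :: (real ^ 'n) set)"
    unfolding islimpt_approachable
  proof (intro allI impI)
    fix e :: real assume "e > 0"
    from octant_arbitrarily_small[OF this] obtain a :: "real ^ 'n" where "a \<in> octant" "norm a < e" by blast
    moreover from \<open>a \<in> octant\<close> have "a \<noteq> 0" by (auto simp: octant_def)
    ultimately show "\<exists>x'\<in>octant. x' \<noteq> 0 \<and> dist x' (0 :: real ^ 'n) < e" by (auto simp: dist_norm)
  qed
  then show ?thesis by (simp add: trivial_limit_within)
qed

proposition boundary_fun_exists:
  fixes F :: "complex ^ 'n \<Rightarrow> complex"
  assumes F: "F \<in> hardy_space"
  shows "\<exists>f. is_boundary_fun F f"
proof -
  define D where "D a b = (\<integral>\<^sup>+x. ennreal ((cmod (F (cvec x a) - F (cvec x b)))\<^sup>2) \<partial>lborel)" for a b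
  have "\<forall>k. \<exists>\<delta>>0. \<forall>a\<in>octant. \<forall>b\<in>octant. norm a < \<delta> \<longrightarrow> norm b < \<delta> \<longrightarrow> D a b \<le> ennreal ((1/4) ^ k)"
    unfolding D_def by (intro allI slices_Cauchy_at_0[OF F]) auto
  then obtain \<delta> :: "nat \<Rightarrow> real" where \<delta>_pos: "\<And>k. \<delta> k > 0"
    and \<delta>: "\<And>k a b. a \<in> octant \<Longrightarrow> b \<in> octant \<Longrightarrow> norm a < \<delta> k \<Longrightarrow> norm b < \<delta> k \<Longrightarrow> D a b \<le> ennreal ((1/4) ^ k)"
    by metis
  \<comment> \<open>The minimum over all indices up to k makes the smallness cumulative:
    \<open>a k\<close> satisfies every earlier threshold, so both consecutive terms and tails of the
    sequence can be compared.\<close>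
  have "\<exists>a\<in>(octant :: (real ^ 'n) set). norm a < Min (\<delta> ` {..k})" for k
    by (rule octant_arbitrarily_small) (simp add: \<delta>_pos)
  then obtain a :: "nat \<Rightarrow> real ^ 'n" where a: "\<And>k. a k \<in> octant" and "\<And>k. norm (a k) < Min (\<delta> ` {..k})"
    by metis
  then have a_small: "norm (a k) < \<delta> j" if "j \<le> k" for j k
    using that by (simp add: Min_gr_iff)
  have [measurable]: "(\<lambda>x. F (cvec x (a k))) \<in> borel_measurable borel" for k
    by (rule hardy_space_slice_measurable[OF F a])
  define f where "f x = lim (\<lambda>k. F (cvec x (a k)))" for x
  have f[measurable]: "f \<in> borel_measurable borel" unfolding f_def by measurable
  have conv: "AE x in lborel. (\<lambda>k. F (cvec x (a k))) \<longlonglongrightarrow> f x"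
  proof -
    have "AE x in lborel. convergent (\<lambda>k. F (cvec x (a k)))"
      using \<delta>[OF a a a_small a_small]
      by (intro AE_convergent_if_rapidly_L2_Cauchy) (auto simp: D_def)
    then show ?thesis by eventually_elim (simp add: f_def convergent_LIMSEQ_iff)
  qed
  \<comment> \<open>Fatou's lemma carries the Cauchy estimate from \<open>a k\<close> to the limit.
    As b ranges over all small heights, this yields convergence along the whole octant filter and
    not only along the chosen sequence.\<close>
  have close: "(\<integral>\<^sup>+x. ennreal ((cmod (F (cvec x b) - f x))\<^sup>2) \<partial>lborel) \<le> ennreal ((1/4) ^ j)"
    if b: "b \<in> octant" "norm b < \<delta> j" for b j
  proof -
    have [measurable]: "(\<lambda>x. F (cvec x b)) \<in> borel_measurable borel"
      by (rule hardy_space_slice_measurable[OF F b(1)])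
    have "(\<integral>\<^sup>+x. ennreal ((cmod (F (cvec x b) - f x))\<^sup>2) \<partial>lborel)
        = (\<integral>\<^sup>+x. liminf (\<lambda>k. ennreal ((cmod (F (cvec x b) - F (cvec x (a k))))\<^sup>2)) \<partial>lborel)"
    proof (rule nn_integral_cong_AE, use conv in eventually_elim)
      fix x assume "(\<lambda>k. F (cvec x (a k))) \<longlonglongrightarrow> f x"
      then have "(\<lambda>k. ennreal ((cmod (F (cvec x b) - F (cvec x (a k))))\<^sup>2)) \<longlonglongrightarrow> ennreal ((cmod (F (cvec x b) - f x))\<^sup>2)"
        by (intro tendsto_intros)
      then show "ennreal ((cmod (F (cvec x b) - f x))\<^sup>2) = liminf (\<lambda>k. ennreal ((cmod (F (cvec x b) - F (cvec x (a k))))\<^sup>2))"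
        by (rule lim_imp_Liminf[OF sequentially_bot, symmetric])
    qed
    also have "\<dots> \<le> liminf (\<lambda>k. D b (a k))"
      unfolding D_def by (rule nn_integral_liminf) measurable
    also have "\<dots> \<le> liminf (\<lambda>k. ennreal ((1/4) ^ j))"
    proof (rule Liminf_mono)
      show "\<forall>\<^sub>F k in sequentially. D b (a k) \<le> ennreal ((1/4) ^ j)"
        using eventually_ge_at_top[of j]
        by eventually_elim (rule \<delta>[OF b(1) a b(2)], rule a_small)
    qed
    also have "\<dots> = ennreal ((1/4) ^ j)" by (rule Liminf_const) simp
    finally show ?thesis .
  qed
  have "is_boundary_fun F f"
    unfolding is_boundary_fun_def
  proof (intro conjI)
    show "((\<lambda>\<eta>. \<integral>\<^sup>+ x. ennreal ((cmod (F (cvec x \<eta>) - f x))\<^sup>2) \<partial>lborel) \<longlongrightarrow> 0) (at 0 within octant)"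
    proof (rule tendsto_zero_ennreal)
      fix r :: real assume "0 < r"
      then obtain j where j: "(1/4) ^ j < r" using real_arch_pow_inv[of r "1/4"] by auto
      have "\<forall>\<^sub>F b in at 0 within octant. b \<in> octant \<and> norm b < \<delta> j"
        unfolding eventually_at using \<delta>_pos[of j] by (auto simp: dist_norm)
      then show "\<forall>\<^sub>F b in at 0 within octant. (\<integral>\<^sup>+ x. ennreal ((cmod (F (cvec x b) - f x))\<^sup>2) \<partial>lborel) < ennreal r"
        by eventually_elim (use close j \<open>0 < r\<close> in \<open>meson ennreal_lessI le_less_trans\<close>)
    qed
    have "(\<integral>\<^sup>+x. ennreal ((cmod (f x))\<^sup>2) \<partial>lborel)
        = (\<integral>\<^sup>+x. ennreal ((cmod (F (cvec x (a 0)) - (F (cvec x (a 0)) - f x)))\<^sup>2) \<partial>lborel)"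
      by simp
    also have "\<dots> \<le> 2 * (\<integral>\<^sup>+x. ennreal ((cmod (F (cvec x (a 0))))\<^sup>2) \<partial>lborel)
        + 2 * (\<integral>\<^sup>+x. ennreal ((cmod (F (cvec x (a 0)) - f x))\<^sup>2) \<partial>lborel)"
      by (rule nn_integral_norm_diff_squared_le) measurable
    also have "\<dots> < \<infinity>"
      using hardy_space_slice_bound[OF F a, of 0] close[OF a a_small, of 0 0]
      by (auto simp: ennreal_mult_less_top dest: le_less_trans[OF _ ennreal_less_top] le_less_trans[OF _ ennreal_one_less_top])
    finally show "(\<integral>\<^sup>+x. ennreal ((cmod (f x))\<^sup>2) \<partial>lborel) < \<infinity>" .
  qed simp
  then show ?thesis by blast
qed

lemma is_boundary_fun_boundary_fun:
  assumes "is_boundary_fun F f"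
  shows "is_boundary_fun F (boundary_fun F)"
  unfolding boundary_fun_def by (rule someI[where P = "is_boundary_fun F", OF assms])

text \<open>The distance of f and g is controlled by their distances to a common slice, which tend
  to 0. This permits replacing the \<open>SOME\<close> choice for the kernels by their explicit
  boundary values under the integral.\<close>

lemma boundary_fun_AE_unique:
  fixes F :: "complex ^ 'n \<Rightarrow> complex"
  assumes f: "is_boundary_fun F f" and g: "is_boundary_fun F g"
    and meas: "\<And>a. a \<in> octant \<Longrightarrow> (\<lambda>x. F (cvec x a)) \<in> borel_measurable borel"
  shows "AE x in lborel. f x = g x"
proof -
  define I where "I f a = (\<integral>\<^sup>+x. ennreal ((cmod (F (cvec x a) - f x))\<^sup>2) \<partial>lborel)" for f a
  have [measurable]: "f \<in> borel_measurable borel" "g \<in> borel_measurable borel"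
    using f g by (auto simp: is_boundary_fun_def)
  have lim: "((\<lambda>a. 2 * I g a + 2 * I f a) \<longlongrightarrow> 2 * 0 + 2 * 0) (at 0 within octant)"
    using f g unfolding is_boundary_fun_def I_def[symmetric]
    by (intro tendsto_add ennreal_tendsto_cmult) auto
  have "(\<integral>\<^sup>+x. ennreal ((cmod (f x - g x))\<^sup>2) \<partial>lborel) \<le> 2 * 0 + 2 * 0"
  proof (rule tendsto_lowerbound[OF lim _ at_0_within_octant_neq_bot])
    have "\<forall>\<^sub>F a in at 0 within octant. a \<in> (octant :: (real ^ 'n) set)"
      by (auto simp: eventually_at intro: exI[of _ 1])
    then show "\<forall>\<^sub>F a in at 0 within octant. (\<integral>\<^sup>+x. ennreal ((cmod (f x - g x))\<^sup>2) \<partial>lborel) \<le> 2 * I g a + 2 * I f a"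
    proof eventually_elim
      case (elim a)
      note [measurable] = meas[OF elim]
      have "(\<integral>\<^sup>+x. ennreal ((cmod ((F (cvec x a) - g x) - (F (cvec x a) - f x)))\<^sup>2) \<partial>lborel) \<le> 2 * I g a + 2 * I f a"
        unfolding I_def by (rule nn_integral_norm_diff_squared_le) measurable
      then show ?case by simp
    qed
  qed
  then have "(\<integral>\<^sup>+x. ennreal ((cmod (f x - g x))\<^sup>2) \<partial>lborel) = 0" by simp
  then have "AE x in lborel. ennreal ((cmod (f x - g x))\<^sup>2) = 0"
    by (subst (asm) nn_integral_0_iff_AE) auto
  then show ?thesis by eventually_elim (simp add: ennreal_eq_0_iff)
qed

section \<open>Product kernels\<close>

lemma nn_integral_lborel_prod_cart:
  fixes f :: "'n::finite \<Rightarrow> real \<Rightarrow> ennreal"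
  assumes [measurable]: "\<And>j. f j \<in> borel_measurable borel"
  shows "(\<integral>\<^sup>+x. (\<Prod>j\<in>UNIV. f j (x $ j)) \<partial>(lborel :: (real ^ 'n) measure)) = (\<Prod>j\<in>UNIV. \<integral>\<^sup>+t. f j t \<partial>lborel)"
proof -
  \<comment> \<open>The left inverse of j -> \<open>axis j 1\<close>, used to turn a product over
    \<open>Basis\<close> into one over coordinates.\<close>
  define ix :: "real ^ 'n \<Rightarrow> 'n" where "ix b = (THE j. b = axis j 1)" for b
  have ix: "ix (axis j 1) = j" for j
    unfolding ix_def by (rule the_equality) (auto simp: axis_eq_axis)
  have B: "Basis = (\<lambda>j. axis j 1 :: real ^ 'n) ` UNIV" by (auto simp: Basis_vec_def)
  have inj: "inj (\<lambda>j. axis j 1 :: real ^ 'n)" by (rule injI) (simp add: axis_eq_axis)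
  have reindex: "(\<Prod>b\<in>Basis. h b) = (\<Prod>j\<in>UNIV. h (axis j 1 :: real ^ 'n))" for h :: "real ^ 'n \<Rightarrow> ennreal"
    unfolding B by (rule prod.reindex[OF inj, unfolded o_def])
  have "(\<integral>\<^sup>+x. (\<Prod>b\<in>Basis. f (ix b) (x \<bullet> b)) \<partial>(lborel :: (real ^ 'n) measure))
      = (\<Prod>b\<in>(Basis :: (real ^ 'n) set). \<integral>\<^sup>+t. f (ix b) t \<partial>lborel)"
    by (rule nn_integral_lborel_prod) auto
  then show ?thesis by (simp add: reindex ix inner_axis)
qed

lemma nn_integral_Poisson_le:
  assumes "0 < y"
  shows "(\<integral>\<^sup>+s. ennreal (y / ((s - x)\<^sup>2 + y\<^sup>2)) \<partial>lborel) \<le> ennreal pi"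
proof -
  define P where "P s = y / (s\<^sup>2 + y\<^sup>2)" for s
  have pos: "s\<^sup>2 + y\<^sup>2 > 0" for s using assms by (simp add: add_nonneg_pos)
  have [measurable]: "P \<in> borel_measurable borel" unfolding P_def by measurable
  have deriv: "((\<lambda>s. arctan (s / y)) has_real_derivative P s) (at s)" for s
    using assms pos[of s] unfolding P_def
    by (auto intro!: derivative_eq_intros simp: field_simps power2_eq_square)
  have half: "(\<integral>\<^sup>+s. ennreal (P s) * indicator {0..} s \<partial>lborel) = ennreal (pi / 2)"
  proof -
    have "((\<lambda>s. arctan (s / y)) \<longlongrightarrow> pi / 2) at_top"
      by (rule filterlim_compose[OF tendsto_arctan_at_top])
         (use assms in \<open>auto intro!: filterlim_at_top_mult_tendsto_pos[OF tendsto_const] filterlim_ident simp: divide_inverse mult.commute\<close>)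
    from nn_integral_FTC_atLeast[OF _ deriv _ this, of 0] show ?thesis
      using assms pos by (auto simp: P_def less_imp_le)
  qed
  have "(\<integral>\<^sup>+s. ennreal (y / ((s - x)\<^sup>2 + y\<^sup>2)) \<partial>lborel) = (\<integral>\<^sup>+s. ennreal (P s) \<partial>lborel)"
    using lborel_nn_integral_translation[of "\<lambda>s. ennreal (P s)" "- x"] by (simp add: P_def)
  \<comment> \<open>The two half-lines share the point 0, hence an inequality here; each of them
    contributes pi/2.\<close>
  also have "\<dots> \<le> (\<integral>\<^sup>+s. ennreal (P s) * indicator {0..} s + ennreal (P (- s)) * indicator {0..} (- s) \<partial>lborel)"
    by (intro nn_integral_mono) (auto simp: indicator_def P_def)
  also have "\<dots> = ennreal (pi / 2) + (\<integral>\<^sup>+s. ennreal (P (- s)) * indicator {0..} (- s) \<partial>lborel)"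
    by (subst nn_integral_add) (auto simp: half)
  also have "(\<integral>\<^sup>+s. ennreal (P (- s)) * indicator {0..} (- s) \<partial>lborel)
      = (\<integral>\<^sup>+s. ennreal (P s) * indicator {0..} s \<partial>distr lborel borel uminus)"
    by (subst nn_integral_distr) auto
  also have "ennreal (pi / 2) + \<dots> = ennreal pi"
    by (simp add: lborel_distr_uminus half flip: ennreal_plus)
  finally show ?thesis .
qed

text \<open>Up to a constant, the square is the Poisson kernel of the tube.\<close>

definition half_Poisson :: "real ^ 'n \<Rightarrow> real ^ 'n \<Rightarrow> real ^ 'n \<Rightarrow> real" where
  "half_Poisson x y \<xi> = (\<Prod>j\<in>UNIV. sqrt (y $ j) / sqrt ((\<xi> $ j - x $ j)\<^sup>2 + (y $ j)\<^sup>2))"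

lemma half_Poisson_nonneg: "y \<in> octant \<Longrightarrow> 0 \<le> half_Poisson x y \<xi>"
  unfolding half_Poisson_def by (intro prod_nonneg) (auto simp: octant_def less_imp_le)

lemma half_Poisson_measurable [measurable]: "half_Poisson x y \<in> borel_measurable borel"
  unfolding half_Poisson_def by measurable

lemma nn_integral_half_Poisson_squared:
  fixes x y :: "real ^ 'n"
  assumes y: "y \<in> octant"
  shows "(\<integral>\<^sup>+\<xi>. ennreal ((half_Poisson x y \<xi>)\<^sup>2) \<partial>lborel) \<le> ennreal (pi ^ CARD('n))"
proof -
  have pos: "0 < y $ j" for j using y by (simp add: octant_def)
  have "(half_Poisson x y \<xi>)\<^sup>2 = (\<Prod>j\<in>UNIV. y $ j / ((\<xi> $ j - x $ j)\<^sup>2 + (y $ j)\<^sup>2))" for \<xi>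
    unfolding half_Poisson_def prod_power_distrib
    by (intro prod.cong) (auto simp: power_divide pos less_imp_le)
  then have "ennreal ((half_Poisson x y \<xi>)\<^sup>2) = (\<Prod>j\<in>UNIV. ennreal (y $ j / ((\<xi> $ j - x $ j)\<^sup>2 + (y $ j)\<^sup>2)))" for \<xi>
    by (simp add: prod_ennreal pos less_imp_le)
  then have "(\<integral>\<^sup>+\<xi>. ennreal ((half_Poisson x y \<xi>)\<^sup>2) \<partial>lborel)
      = (\<Prod>j\<in>UNIV. \<integral>\<^sup>+t. ennreal (y $ j / ((t - x $ j)\<^sup>2 + (y $ j)\<^sup>2)) \<partial>lborel)"
    using nn_integral_lborel_prod_cart[of "\<lambda>j t. ennreal (y $ j / ((t - x $ j)\<^sup>2 + (y $ j)\<^sup>2))"] by simp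
  also have "\<dots> \<le> (\<Prod>j\<in>(UNIV :: 'n set). ennreal pi)"
    by (intro prod_mono_ennreal nn_integral_Poisson_le pos)
  also have "\<dots> = ennreal (pi ^ CARD('n))" by (simp add: ennreal_power)
  finally show ?thesis .
qed

text \<open>Two bounds for one factor: supremum times length, good for large heights
  (\<open>far\<close>), and p <= 1 + p^2 with the Poisson integral, uniform in the height
  (\<open>near\<close>). The first is spent on the coordinate m, which is left free so that it can
  be the one known to be large; the others use the second.\<close>

lemma nn_integral_half_Poisson_box:
  fixes x y :: "real ^ 'n"
  assumes y: "y \<in> octant" and R: "0 \<le> R"
  shows "(\<integral>\<^sup>+\<xi>. ennreal (half_Poisson x y \<xi> * indicator {\<xi>. \<forall>j. \<bar>\<xi> $ j\<bar> \<le> R} \<xi>) \<partial>lborel)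
    \<le> ennreal (2 * R / sqrt (y $ m) * (2 * R + pi) ^ (CARD('n) - 1))"
proof -
  have pos: "0 < y $ j" for j using y by (simp add: octant_def)
  define p where "p j t = sqrt (y $ j) / sqrt ((t - x $ j)\<^sup>2 + (y $ j)\<^sup>2)" for j t
  have [measurable]: "p j \<in> borel_measurable borel" for j unfolding p_def by measurable
  have p_pos: "0 \<le> p j t" for j t using pos[of j] by (simp add: p_def less_imp_le)
  have p_le: "p j t \<le> 1 / sqrt (y $ j)" for j t
  proof -
    have "y $ j \<le> sqrt ((t - x $ j)\<^sup>2 + (y $ j)\<^sup>2)"
      by (rule real_le_rsqrt) simp
    then have "p j t \<le> sqrt (y $ j) / (y $ j)"
      unfolding p_def using pos[of j] by (intro divide_left_mono mult_pos_pos) (auto simp: add_nonneg_pos)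
    also have "\<dots> = 1 / sqrt (y $ j)"
      using pos[of j] by (simp add: field_simps)
    finally show ?thesis .
  qed
  have far: "(\<integral>\<^sup>+t. ennreal (p j t * indicator {-R..R} t) \<partial>lborel) \<le> ennreal (2 * R / sqrt (y $ j))" for j
  proof -
    have "(\<integral>\<^sup>+t. ennreal (p j t * indicator {-R..R} t) \<partial>lborel)
        \<le> (\<integral>\<^sup>+t. ennreal (1 / sqrt (y $ j)) * indicator {-R..R} t \<partial>lborel)"
      using p_le by (intro nn_integral_mono) (auto simp: indicator_def intro!: ennreal_leI)
    also have "\<dots> = ennreal (2 * R / sqrt (y $ j))"
      using R pos[of j]
      by (subst nn_integral_cmult_indicator) (auto simp flip: ennreal_mult)
    finally show ?thesis .
  qed
  have near: "(\<integral>\<^sup>+t. ennreal (p j t * indicator {-R..R} t) \<partial>lborel) \<le> ennreal (2 * R + pi)" for j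
  proof -
    have sq: "(p j t)\<^sup>2 = y $ j / ((t - x $ j)\<^sup>2 + (y $ j)\<^sup>2)" for t
      unfolding p_def power_divide using pos[of j] by (subst (1 2) real_sqrt_pow2) auto
    have "(\<integral>\<^sup>+t. ennreal (p j t * indicator {-R..R} t) \<partial>lborel)
        \<le> (\<integral>\<^sup>+t. indicator {-R..R} t + ennreal ((p j t)\<^sup>2) \<partial>lborel)"
    proof (rule nn_integral_mono)
      fix t
      have "p j t \<le> 1 + (p j t)\<^sup>2"
        using sum_squares_bound[of "p j t" 1] p_pos[of j t] by (simp add: power2_eq_square)
      then have "ennreal (p j t) \<le> 1 + ennreal ((p j t)\<^sup>2)"
        using ennreal_leI[of "p j t" "1 + (p j t)\<^sup>2"] by simp
      then show "ennreal (p j t * indicator {-R..R} t) \<le> indicator {-R..R} t + ennreal ((p j t)\<^sup>2)"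
        by (auto simp: indicator_def)
    qed
    also have "\<dots> = ennreal (2 * R) + (\<integral>\<^sup>+t. ennreal ((p j t)\<^sup>2) \<partial>lborel)"
      using R by (subst nn_integral_add) auto
    also have "\<dots> \<le> ennreal (2 * R) + ennreal pi"
      unfolding sq by (intro add_left_mono nn_integral_Poisson_le pos)
    also have "\<dots> = ennreal (2 * R + pi)" using R by simp
    finally show ?thesis .
  qed
  have "half_Poisson x y \<xi> * indicator {\<xi>. \<forall>j. \<bar>\<xi> $ j\<bar> \<le> R} \<xi> = (\<Prod>j\<in>UNIV. p j (\<xi> $ j) * indicator {-R..R} (\<xi> $ j))" for \<xi>
  proof -
    have "indicator {\<xi>. \<forall>j. \<bar>\<xi> $ j\<bar> \<le> R} \<xi> = (\<Prod>j\<in>UNIV. indicator {-R..R} (\<xi> $ j) :: real)"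
    proof (cases "\<forall>j. \<bar>\<xi> $ j\<bar> \<le> R")
      case True
      then have "- R \<le> \<xi> $ j \<and> \<xi> $ j \<le> R" for j by (metis abs_le_iff minus_le_iff)
      with True show ?thesis by simp
    next
      case False
      then obtain j where "\<not> \<bar>\<xi> $ j\<bar> \<le> R" by blast
      then have "indicator {-R..R} (\<xi> $ j) = (0 :: real)" by (auto simp: indicator_def)
      then have "(\<Prod>j\<in>UNIV. indicator {-R..R} (\<xi> $ j)) = (0 :: real)" by (intro prod_zero) auto
      with False show ?thesis by simp
    qed
    then show ?thesis by (simp only: half_Poisson_def p_def prod.distrib)
  qed
  then have eq: "ennreal (half_Poisson x y \<xi> * indicator {\<xi>. \<forall>j. \<bar>\<xi> $ j\<bar> \<le> R} \<xi>)
      = (\<Prod>j\<in>UNIV. ennreal (p j (\<xi> $ j) * indicator {-R..R} (\<xi> $ j)))" for \<xi>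
    by (subst prod_ennreal) (simp_all add: p_pos)
  have "(\<integral>\<^sup>+\<xi>. ennreal (half_Poisson x y \<xi> * indicator {\<xi>. \<forall>j. \<bar>\<xi> $ j\<bar> \<le> R} \<xi>) \<partial>lborel)
      = (\<Prod>j\<in>UNIV. \<integral>\<^sup>+t. ennreal (p j t * indicator {-R..R} t) \<partial>lborel)"
    unfolding eq by (rule nn_integral_lborel_prod_cart) measurable
  also have "\<dots> = (\<integral>\<^sup>+t. ennreal (p m t * indicator {-R..R} t) \<partial>lborel)
      * (\<Prod>j\<in>UNIV - {m}. \<integral>\<^sup>+t. ennreal (p j t * indicator {-R..R} t) \<partial>lborel)"
    by (rule prod.remove) auto
  also have "\<dots> \<le> ennreal (2 * R / sqrt (y $ m)) * (\<Prod>j\<in>UNIV - {m}. ennreal (2 * R + pi))"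
    by (intro mult_mono far prod_mono_ennreal near) auto
  also have "\<dots> = ennreal (2 * R / sqrt (y $ m) * (2 * R + pi) ^ (CARD('n) - 1))"
    using R pos[of m]
    by (simp add: ennreal_power card_Diff_singleton ennreal_mult[symmetric] del: ennreal_plus)
  finally show ?thesis .
qed

section \<open>Pointwise size and norms of the differentiated kernels\<close>

text \<open>The estimates below are stated for \<open>phi_formula\<close>, since they are also
  applied at \<eta> = 0, outside the tube where the closed form of \<open>phi\<close> is
  established.\<close>

lemma phi_eq_phi_formula:
  assumes "y \<in> octant" "\<eta> \<in> octant"
  shows "phi \<alpha> (cvec x y) (cvec \<xi> \<eta>) = phi_formula (cvec \<xi> \<eta>) \<alpha> (cvec x y)"
  using assms by (simp only: phi_closed_form phi_formula_def tube_cvec)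

lemma norm_phi_formula:
  fixes x y \<xi> \<eta> :: "real ^ 'n"
  shows "cmod (phi_formula (cvec \<xi> \<eta>) \<alpha> (cvec x y)) = (1 / (2 * pi)) ^ CARD('n) *
    (\<Prod>j\<in>UNIV. fact (\<alpha> j) / sqrt ((\<xi> $ j - x $ j)\<^sup>2 + (\<eta> $ j + y $ j)\<^sup>2) ^ (\<alpha> j + 1))"
proof -
  have "cmod (cvec \<xi> \<eta> $ j - cnj (cvec x y $ j)) = sqrt ((\<xi> $ j - x $ j)\<^sup>2 + (\<eta> $ j + y $ j)\<^sup>2)" for j
    by (simp add: cmod_def)
  then show ?thesis
    unfolding phi_formula_def norm_mult norm_power prod_norm[symmetric] norm_divide
    by (simp add: norm_mult)
qed

lemma phi_formula_measurable [measurable]: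
  fixes x y \<eta> :: "real ^ 'n"
  shows "(\<lambda>\<xi>. phi_formula (cvec \<xi> \<eta>) \<alpha> (cvec x y)) \<in> borel_measurable borel"
  unfolding phi_formula_def cvec_nth complex_cnj Complex_eq by measurable

text \<open>The peak modulus of the boundary kernel, attained at \<xi> = x.\<close>

definition phi_scale :: "('n::finite \<Rightarrow> nat) \<Rightarrow> real ^ 'n \<Rightarrow> real" where
  "phi_scale \<alpha> y = (1 / (2 * pi)) ^ CARD('n) * (\<Prod>j\<in>UNIV. fact (\<alpha> j) / (y $ j) ^ (\<alpha> j + 1))"

lemma phi_scale_pos: "y \<in> octant \<Longrightarrow> 0 < phi_scale \<alpha> y"
  unfolding phi_scale_def by (intro mult_pos_pos prod_pos) (auto simp: octant_def)

text \<open>Raising \<eta> enlarges every denominator. The boundary slice thus dominates all others,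
  which yields both the finite Hardy norm and the majorant for convergence at the boundary.\<close>

lemma norm_phi_formula_mono:
  assumes "y \<in> octant" and "\<And>j. 0 \<le> \<eta> $ j"
  shows "cmod (phi_formula (cvec \<xi> \<eta>) \<alpha> (cvec x y)) \<le> cmod (phi_formula (cvec \<xi> 0) \<alpha> (cvec x y))"
  unfolding norm_phi_formula
proof (intro mult_left_mono prod_mono conjI)
  fix j
  have y: "0 < y $ j" using assms by (simp add: octant_def)
  show "fact (\<alpha> j) / sqrt ((\<xi> $ j - x $ j)\<^sup>2 + (\<eta> $ j + y $ j)\<^sup>2) ^ (\<alpha> j + 1)
      \<le> fact (\<alpha> j) / sqrt ((\<xi> $ j - x $ j)\<^sup>2 + (0 $ j + y $ j)\<^sup>2) ^ (\<alpha> j + 1)"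
  proof (rule divide_left_mono)
    show "sqrt ((\<xi> $ j - x $ j)\<^sup>2 + (0 $ j + y $ j)\<^sup>2) ^ (\<alpha> j + 1)
        \<le> sqrt ((\<xi> $ j - x $ j)\<^sup>2 + (\<eta> $ j + y $ j)\<^sup>2) ^ (\<alpha> j + 1)"
      using y assms(2)[of j] by (intro power_mono real_sqrt_le_mono add_left_mono) auto
    have "0 < \<eta> $ j + y $ j" using y assms(2)[of j] by linarith
    then show "0 < sqrt ((\<xi> $ j - x $ j)\<^sup>2 + (\<eta> $ j + y $ j)\<^sup>2) ^ (\<alpha> j + 1) *
        sqrt ((\<xi> $ j - x $ j)\<^sup>2 + (0 $ j + y $ j)\<^sup>2) ^ (\<alpha> j + 1)"
      using y assms(2)[of j] by (intro mult_pos_pos zero_less_power real_sqrt_gt_zero add_nonneg_pos) auto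
  qed simp
qed auto

text \<open>Of the \<alpha> j + 1 factors 1/r in coordinate j only one is kept; the rest are at most
  1 / y_j. All multi-indices thereby reduce to the same kernel, and \<alpha> survives only in the
  scale.\<close>

lemma norm_phi_formula_boundary_le:
  fixes x y :: "real ^ 'n"
  assumes y: "y \<in> octant"
  shows "cmod (phi_formula (cvec \<xi> 0) \<alpha> (cvec x y))
    \<le> phi_scale \<alpha> y * (\<Prod>j\<in>UNIV. sqrt (y $ j)) * half_Poisson x y \<xi>"
proof -
  have "(\<Prod>j\<in>UNIV. fact (\<alpha> j) / sqrt ((\<xi> $ j - x $ j)\<^sup>2 + (0 $ j + y $ j)\<^sup>2) ^ (\<alpha> j + 1))
     \<le> (\<Prod>j\<in>UNIV. (fact (\<alpha> j) / (y $ j) ^ (\<alpha> j + 1)) * (sqrt (y $ j) * (sqrt (y $ j) / sqrt ((\<xi> $ j - x $ j)\<^sup>2 + (y $ j)\<^sup>2))))"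
  proof (intro prod_mono conjI)
    fix j
    have pos: "0 < y $ j" using y by (simp add: octant_def)
    define r where "r = sqrt ((\<xi> $ j - x $ j)\<^sup>2 + (y $ j)\<^sup>2)"
    have r: "y $ j \<le> r" unfolding r_def by (rule real_le_rsqrt) simp
    have "(y $ j) ^ \<alpha> j \<le> r ^ \<alpha> j" using r pos by (intro power_mono) auto
    then have "fact (\<alpha> j) / r ^ (\<alpha> j + 1) \<le> fact (\<alpha> j) / ((y $ j) ^ \<alpha> j * r)"
      using r pos by (intro divide_left_mono) (auto simp: mult.commute intro!: mult_left_mono mult_pos_pos)
    also have "\<dots> = (fact (\<alpha> j) / (y $ j) ^ (\<alpha> j + 1)) * (sqrt (y $ j) * (sqrt (y $ j) / r))"
      using r pos by (simp add: field_simps)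
    finally show "fact (\<alpha> j) / sqrt ((\<xi> $ j - x $ j)\<^sup>2 + (0 $ j + y $ j)\<^sup>2) ^ (\<alpha> j + 1)
        \<le> (fact (\<alpha> j) / (y $ j) ^ (\<alpha> j + 1)) * (sqrt (y $ j) * (sqrt (y $ j) / sqrt ((\<xi> $ j - x $ j)\<^sup>2 + (y $ j)\<^sup>2)))"
      by (simp add: r_def)
  qed auto
  also have "\<dots> = (\<Prod>j\<in>UNIV. fact (\<alpha> j) / (y $ j) ^ (\<alpha> j + 1)) * ((\<Prod>j\<in>UNIV. sqrt (y $ j)) * half_Poisson x y \<xi>)"
    by (simp only: prod.distrib half_Poisson_def)
  finally have "(1 / (2 * pi)) ^ CARD('n) * (\<Prod>j\<in>UNIV. fact (\<alpha> j) / sqrt ((\<xi> $ j - x $ j)\<^sup>2 + (0 $ j + y $ j)\<^sup>2) ^ (\<alpha> j + 1))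
     \<le> (1 / (2 * pi)) ^ CARD('n) * ((\<Prod>j\<in>UNIV. fact (\<alpha> j) / (y $ j) ^ (\<alpha> j + 1)) * ((\<Prod>j\<in>UNIV. sqrt (y $ j)) * half_Poisson x y \<xi>))"
    by (rule mult_left_mono) simp
  then show ?thesis unfolding norm_phi_formula phi_scale_def by (simp only: mult.assoc)
qed

lemma phi_formula_boundary_L2:
  fixes x y :: "real ^ 'n"
  assumes y: "y \<in> octant"
  shows "(\<integral>\<^sup>+\<xi>. ennreal ((cmod (phi_formula (cvec \<xi> 0) \<alpha> (cvec x y)))\<^sup>2) \<partial>lborel) < \<infinity>"
proof -
  define c where "c = phi_scale \<alpha> y * (\<Prod>j\<in>UNIV. sqrt (y $ j))"
  have "(\<integral>\<^sup>+\<xi>. ennreal ((cmod (phi_formula (cvec \<xi> 0) \<alpha> (cvec x y)))\<^sup>2) \<partial>lborel)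
      \<le> (\<integral>\<^sup>+\<xi>. ennreal (c\<^sup>2) * ennreal ((half_Poisson x y \<xi>)\<^sup>2) \<partial>lborel)"
  proof (rule nn_integral_mono)
    fix \<xi>
    have "(cmod (phi_formula (cvec \<xi> 0) \<alpha> (cvec x y)))\<^sup>2 \<le> (c * half_Poisson x y \<xi>)\<^sup>2"
      using norm_phi_formula_boundary_le[OF y] unfolding c_def by (intro power_mono) auto
    then show "ennreal ((cmod (phi_formula (cvec \<xi> 0) \<alpha> (cvec x y)))\<^sup>2) \<le> ennreal (c\<^sup>2) * ennreal ((half_Poisson x y \<xi>)\<^sup>2)"
      by (simp add: ennreal_leI power_mult_distrib flip: ennreal_mult)
  qed
  also have "\<dots> = ennreal (c\<^sup>2) * (\<integral>\<^sup>+\<xi>. ennreal ((half_Poisson x y \<xi>)\<^sup>2) \<partial>lborel)"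
    by (rule nn_integral_cmult) measurable
  also have "\<dots> \<le> ennreal (c\<^sup>2) * ennreal (pi ^ CARD('n))"
    by (intro mult_left_mono nn_integral_half_Poisson_squared y) simp
  also have "\<dots> < \<infinity>" by (simp add: ennreal_mult_less_top)
  finally show ?thesis .
qed

text \<open>Needed for the lower bound on \<open>hardy_norm\<close>, because \<open>enn2real\<close>
  would send an infinite value to 0.\<close>

lemma hardy_norm_sq_phi_finite:
  fixes x y :: "real ^ 'n"
  assumes y: "y \<in> octant"
  shows "hardy_norm_sq (phi \<alpha> (cvec x y)) < \<infinity>"
proof -
  have "hardy_norm_sq (phi \<alpha> (cvec x y)) \<le> (\<integral>\<^sup>+\<xi>. ennreal ((cmod (phi_formula (cvec \<xi> 0) \<alpha> (cvec x y)))\<^sup>2) \<partial>lborel)"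
    unfolding hardy_norm_sq_def
  proof (intro SUP_least nn_integral_mono ennreal_leI power_mono)
    fix \<eta> \<xi> :: "real ^ 'n" assume "\<eta> \<in> octant"
    then show "cmod (phi \<alpha> (cvec x y) (cvec \<xi> \<eta>)) \<le> cmod (phi_formula (cvec \<xi> 0) \<alpha> (cvec x y))"
      using norm_phi_formula_mono[OF y, of \<eta> \<xi> \<alpha> x]
      by (simp add: phi_eq_phi_formula[OF y] octant_def less_imp_le)
  qed simp
  also note phi_formula_boundary_L2[OF y]
  finally show ?thesis .
qed

text \<open>
  The slice at height \<open>\<eta> = y\<close>, restricted to the box \<open>\<bar>\<xi> - x\<bar> \<le> y\<close>, already has the right size.
\<close>

lemma hardy_norm_phi_ge:
  fixes x y :: "real ^ 'n"
  assumes y: "y \<in> octant"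
  shows "phi_scale \<alpha> y * (\<Prod>j\<in>UNIV. sqrt (y $ j)) \<le> hardy_norm (phi \<alpha> (cvec x y)) * (\<Prod>j\<in>(UNIV :: 'n set). sqrt 5 ^ (\<alpha> j + 1))"
proof -
  have pos: "0 < y $ j" for j using y by (simp add: octant_def)
  \<comment> \<open>At height \<eta> = y and on the box, each distance is at most the square root of
    y_j^2 + (2 y_j)^2, that is sqrt 5 * y_j; this enters to the power \<alpha> j + 1.\<close>
  define K where "K = (\<Prod>j\<in>(UNIV :: 'n set). sqrt 5 ^ (\<alpha> j + 1))"
  define c where "c = phi_scale \<alpha> y / K"
  have K: "K > 0" unfolding K_def by (intro prod_pos) auto
  have c: "c > 0" using K phi_scale_pos[OF y] by (simp add: c_def)
  define Q where "Q = cbox (x - y) (x + y)"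
  have slice: "c \<le> cmod (phi \<alpha> (cvec x y) (cvec \<xi> y))" if "\<xi> \<in> Q" for \<xi>
  proof -
    have "c = (1 / (2 * pi)) ^ CARD('n) * (\<Prod>j\<in>UNIV. fact (\<alpha> j) / (sqrt 5 * y $ j) ^ (\<alpha> j + 1))"
      unfolding c_def phi_scale_def K_def times_divide_eq_right[symmetric] prod_dividef[symmetric]
      by (simp only: power_mult_distrib divide_divide_eq_left mult.commute)
    also have "\<dots> \<le> cmod (phi_formula (cvec \<xi> y) \<alpha> (cvec x y))"
      unfolding norm_phi_formula
    proof (intro mult_left_mono prod_mono conjI)
      fix j
      have "\<bar>\<xi> $ j - x $ j\<bar> \<le> y $ j" using that by (auto simp: Q_def mem_box_cart abs_le_iff algebra_simps)
      then have "(\<xi> $ j - x $ j)\<^sup>2 \<le> (y $ j)\<^sup>2" using pos[of j] by (simp add: abs_le_square_iff[symmetric])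
      then have "sqrt ((\<xi> $ j - x $ j)\<^sup>2 + (y $ j + y $ j)\<^sup>2) \<le> sqrt (5 * (y $ j)\<^sup>2)"
        by (intro real_sqrt_le_mono) (simp add: power2_eq_square algebra_simps)
      also have "\<dots> = sqrt 5 * y $ j" using pos[of j] by (simp add: real_sqrt_mult)
      finally have le: "sqrt ((\<xi> $ j - x $ j)\<^sup>2 + (y $ j + y $ j)\<^sup>2) \<le> sqrt 5 * y $ j" .
      have "0 < sqrt ((\<xi> $ j - x $ j)\<^sup>2 + (y $ j + y $ j)\<^sup>2)"
        using pos[of j] by (intro real_sqrt_gt_zero add_nonneg_pos) auto
      with le pos[of j] show "fact (\<alpha> j) / (sqrt 5 * y $ j) ^ (\<alpha> j + 1)
          \<le> fact (\<alpha> j) / sqrt ((\<xi> $ j - x $ j)\<^sup>2 + (y $ j + y $ j)\<^sup>2) ^ (\<alpha> j + 1)"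
        by (intro divide_left_mono power_mono mult_pos_pos zero_less_power) auto
      show "0 \<le> fact (\<alpha> j) / (sqrt 5 * y $ j) ^ (\<alpha> j + 1)" using pos[of j] by simp
    qed simp
    finally show ?thesis by (simp only: phi_eq_phi_formula[OF y y])
  qed
  \<comment> \<open>The box has volume 2^n times the product of the y_j. The power of 2 is dropped,
    and the square root of the rest is the factor in the claim.\<close>
  have "ennreal (c\<^sup>2 * (\<Prod>j\<in>UNIV. y $ j)) \<le> ennreal (c\<^sup>2) * emeasure lborel Q"
  proof -
    have "Q \<noteq> {}" by (auto simp: Q_def mem_box_cart pos less_imp_le intro!: exI[of _ x] simp flip: ex_in_conv)
    then have "measure lborel Q = (\<Prod>j\<in>UNIV. 2 * y $ j)"
      unfolding Q_def by (subst content_cbox_cart) auto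
    moreover have "(\<Prod>j\<in>UNIV. y $ j) \<le> (\<Prod>j\<in>UNIV. 2 * y $ j)"
      by (intro prod_mono) (auto simp: pos less_imp_le)
    ultimately have "c\<^sup>2 * (\<Prod>j\<in>UNIV. y $ j) \<le> c\<^sup>2 * measure lborel Q" by (intro mult_left_mono) auto
    moreover have "emeasure lborel Q = ennreal (measure lborel Q)"
      using emeasure_lborel_cbox_finite[of "x - y" "x + y"]
      by (intro emeasure_eq_ennreal_measure) (auto simp: Q_def)
    ultimately show ?thesis by (simp add: ennreal_leI flip: ennreal_mult)
  qed
  also have "\<dots> = (\<integral>\<^sup>+\<xi>. ennreal (c\<^sup>2) * indicator Q \<xi> \<partial>lborel)"
    by (subst nn_integral_cmult_indicator) (auto simp: Q_def)
  also have "\<dots> \<le> (\<integral>\<^sup>+\<xi>. ennreal ((cmod (phi \<alpha> (cvec x y) (cvec \<xi> y)))\<^sup>2) \<partial>lborel)"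
    using slice c by (intro nn_integral_mono) (auto simp: indicator_def intro!: ennreal_leI power_mono)
  also have "\<dots> \<le> hardy_norm_sq (phi \<alpha> (cvec x y))"
    unfolding hardy_norm_sq_def by (rule SUP_upper[OF y])
  also have "\<dots> = ennreal (enn2real (hardy_norm_sq (phi \<alpha> (cvec x y))))"
    using hardy_norm_sq_phi_finite[OF y] by simp
  finally have "c\<^sup>2 * (\<Prod>j\<in>UNIV. y $ j) \<le> enn2real (hardy_norm_sq (phi \<alpha> (cvec x y)))"
    by (subst (asm) ennreal_le_iff) auto
  then have "sqrt (c\<^sup>2 * (\<Prod>j\<in>UNIV. y $ j)) \<le> hardy_norm (phi \<alpha> (cvec x y))"
    unfolding hardy_norm_def by (rule real_sqrt_le_mono)
  moreover have "sqrt (\<Prod>j\<in>UNIV. y $ j) = (\<Prod>j\<in>UNIV. sqrt (y $ j))"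
  proof -
    have "(\<Prod>j\<in>UNIV. sqrt (y $ j))\<^sup>2 = (\<Prod>j\<in>UNIV. y $ j)"
      unfolding prod_power_distrib using pos by (intro prod.cong) (auto simp: less_imp_le)
    moreover have "0 \<le> (\<Prod>j\<in>UNIV. sqrt (y $ j))" using pos by (intro prod_nonneg) (auto simp: less_imp_le)
    ultimately show ?thesis by (metis real_sqrt_unique)
  qed
  ultimately have "c * (\<Prod>j\<in>UNIV. sqrt (y $ j)) \<le> hardy_norm (phi \<alpha> (cvec x y))"
    using c by (simp add: real_sqrt_mult)
  then show ?thesis unfolding K_def[symmetric] using K by (simp add: c_def field_simps)
qed

section \<open>Boundary values of the kernels\<close>

text \<open>Dominated convergence: for fixed z in the tube the denominators do not vanish at \<eta>
  = 0, so the kernels converge pointwise. Domination by the boundary slice gives the majorant with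
  constant 2 + 2 = 4. Convergence is tested along sequences, as that theorem requires.\<close>

lemma is_boundary_fun_phi:
  fixes x y :: "real ^ 'n"
  assumes y: "y \<in> octant"
  shows "is_boundary_fun (phi \<alpha> (cvec x y)) (\<lambda>\<xi>. phi_formula (cvec \<xi> 0) \<alpha> (cvec x y))"
  unfolding is_boundary_fun_def
proof (intro conjI)
  define g where "g \<eta> \<xi> = phi_formula (cvec \<xi> \<eta>) \<alpha> (cvec x y)" for \<eta> \<xi>
  have [measurable]: "g \<eta> \<in> borel_measurable borel" for \<eta> unfolding g_def by measurable
  show "(\<lambda>\<xi>. phi_formula (cvec \<xi> 0) \<alpha> (cvec x y)) \<in> borel_measurable lborel" by measurable
  show L2: "(\<integral>\<^sup>+\<xi>. ennreal ((cmod (phi_formula (cvec \<xi> 0) \<alpha> (cvec x y)))\<^sup>2) \<partial>lborel) < \<infinity>"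
    by (rule phi_formula_boundary_L2[OF y])
  show "((\<lambda>\<eta>. \<integral>\<^sup>+\<xi>. ennreal ((cmod (phi \<alpha> (cvec x y) (cvec \<xi> \<eta>) - phi_formula (cvec \<xi> 0) \<alpha> (cvec x y)))\<^sup>2) \<partial>lborel) \<longlongrightarrow> 0)
      (at 0 within octant)"
    unfolding tendsto_at_iff_sequentially o_def
  proof (intro allI impI)
    fix X :: "nat \<Rightarrow> real ^ 'n"
    assume X: "\<forall>i. X i \<in> octant - {0}" "X \<longlonglongrightarrow> 0"
    have "(\<lambda>i. \<integral>\<^sup>+\<xi>. ennreal ((cmod (g (X i) \<xi> - g 0 \<xi>))\<^sup>2) \<partial>lborel) \<longlonglongrightarrow> (\<integral>\<^sup>+\<xi>. 0 \<partial>(lborel :: (real ^ 'n) measure))"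
    proof (rule nn_integral_dominated_convergence)
      show "(\<integral>\<^sup>+\<xi>. ennreal (4 * (cmod (g 0 \<xi>))\<^sup>2) \<partial>lborel) < \<infinity>"
        using L2 by (simp add: g_def ennreal_mult nn_integral_cmult ennreal_mult_less_top)
      show "AE \<xi> in lborel. ennreal ((cmod (g (X i) \<xi> - g 0 \<xi>))\<^sup>2) \<le> ennreal (4 * (cmod (g 0 \<xi>))\<^sup>2)" for i
      proof (intro AE_I2 ennreal_leI)
        fix \<xi>
        have "cmod (g (X i) \<xi>) \<le> cmod (g 0 \<xi>)"
          unfolding g_def using X(1) by (intro norm_phi_formula_mono y) (auto simp: octant_def less_imp_le)
        then have "(cmod (g (X i) \<xi>))\<^sup>2 \<le> (cmod (g 0 \<xi>))\<^sup>2" by (intro power_mono) auto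
        then show "(cmod (g (X i) \<xi> - g 0 \<xi>))\<^sup>2 \<le> 4 * (cmod (g 0 \<xi>))\<^sup>2"
          using norm_diff_squared_le[of "g (X i) \<xi>" "g 0 \<xi>"] by linarith
      qed
      show "AE \<xi> in lborel. (\<lambda>i. ennreal ((cmod (g (X i) \<xi> - g 0 \<xi>))\<^sup>2)) \<longlonglongrightarrow> 0"
      proof (rule AE_I2)
        fix \<xi>
        have "0 < Im (cvec \<xi> 0 $ j - cnj (cvec x y $ j))" for j
          using y by (simp add: octant_def)
        then have nz: "cvec \<xi> 0 $ j - cnj (cvec x y $ j) \<noteq> 0" for j
          by (metis less_irrefl zero_complex.sel(2))
        have "continuous_on UNIV (\<lambda>\<eta>. cvec \<xi> \<eta>)" by (intro continuous_intros)
        from continuous_on_tendsto_compose[OF this X(2)]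
        have lim: "(\<lambda>i. cvec \<xi> (X i)) \<longlonglongrightarrow> cvec \<xi> 0" by simp
        have "(\<lambda>i. g (X i) \<xi>) \<longlonglongrightarrow> g 0 \<xi>"
          unfolding g_def phi_formula_def
          by (intro tendsto_intros lim power_not_zero nz)
        then have "(\<lambda>i. ennreal ((cmod (g (X i) \<xi> - g 0 \<xi>))\<^sup>2)) \<longlonglongrightarrow> ennreal ((cmod (g 0 \<xi> - g 0 \<xi>))\<^sup>2)"
          by (intro tendsto_intros)
        then show "(\<lambda>i. ennreal ((cmod (g (X i) \<xi> - g 0 \<xi>))\<^sup>2)) \<longlonglongrightarrow> 0" by simp
      qed
    qed measurable
    moreover have "phi \<alpha> (cvec x y) (cvec \<xi> (X i)) = g (X i) \<xi>" for i \<xi>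
      unfolding g_def using X(1) by (intro phi_eq_phi_formula y) auto
    ultimately show "(\<lambda>i. \<integral>\<^sup>+\<xi>. ennreal ((cmod (phi \<alpha> (cvec x y) (cvec \<xi> (X i)) - phi_formula (cvec \<xi> 0) \<alpha> (cvec x y)))\<^sup>2) \<partial>lborel) \<longlonglongrightarrow> 0"
      by (simp add: g_def)
  qed
qed

lemma boundary_fun_phi:
  fixes x y :: "real ^ 'n"
  assumes y: "y \<in> octant"
  shows "AE \<xi> in lborel. boundary_fun (phi \<alpha> (cvec x y)) \<xi> = phi_formula (cvec \<xi> 0) \<alpha> (cvec x y)"
proof (rule boundary_fun_AE_unique)
  show "is_boundary_fun (phi \<alpha> (cvec x y)) (boundary_fun (phi \<alpha> (cvec x y)))"
    by (rule is_boundary_fun_boundary_fun[OF is_boundary_fun_phi[OF y]])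
  show "is_boundary_fun (phi \<alpha> (cvec x y)) (\<lambda>\<xi>. phi_formula (cvec \<xi> 0) \<alpha> (cvec x y))"
    by (rule is_boundary_fun_phi[OF y])
  show "(\<lambda>\<xi>. phi \<alpha> (cvec x y) (cvec \<xi> a)) \<in> borel_measurable borel" if "a \<in> octant" for a
    unfolding phi_eq_phi_formula[OF y that] by measurable
qed

section \<open>Decay of the normalised inner products\<close>

text \<open>
  Split \<open>f\<close> into a bounded part supported in a box and a rest that is small in \<open>L\<^sup>2\<close>.  On the
  box, the coordinate with the largest \<open>y $ k\<close> contributes a factor \<open>O(1 / sqrt (y $ k))\<close>,
  while the other factors stay bounded, even if some \<open>y $ j\<close> tend to \<open>0\<close>.
\<close>

proposition half_Poisson_vanishes:
  fixes f :: "real ^ 'n \<Rightarrow> complex"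
  assumes [measurable]: "f \<in> borel_measurable borel"
    and L2: "(\<integral>\<^sup>+\<xi>. ennreal ((cmod (f \<xi>))\<^sup>2) \<partial>lborel) < \<infinity>" and \<epsilon>: "0 < \<epsilon>"
  shows "\<exists>T. \<forall>x. \<forall>y\<in>octant. T \<le> norm y \<longrightarrow>
    (\<integral>\<^sup>+\<xi>. ennreal (cmod (f \<xi>) * half_Poisson x y \<xi>) \<partial>lborel) \<le> ennreal \<epsilon>"
proof -
  define n where "n = CARD('n)"
  have n: "0 < n" by (simp add: n_def)
  \<comment> \<open>The weight in the inequality uv <= u^2 + v^2 used off \<open>E m\<close>:
    \<delta> times the bound pi^n for the squared kernel is \<epsilon>/3. The tail of f is later
    made smaller than \<delta> * \<epsilon> / 3, to offset its weight 1 / \<delta>.\<close>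
  define \<delta> where "\<delta> = \<epsilon> / (3 * pi ^ n)"
  have \<delta>: "0 < \<delta>" using \<epsilon> by (simp add: \<delta>_def)
  define E where "E m = {\<xi>. cmod (f \<xi>) \<le> real m \<and> (\<forall>j. \<bar>\<xi> $ j\<bar> \<le> real m)}" for m
  have E_eq: "E m = {\<xi>\<in>space borel. cmod (f \<xi>) \<le> real m} \<inter> (\<Inter>j. {\<xi>\<in>space borel. \<bar>\<xi> $ j\<bar> \<le> real m})" for m
    by (auto simp: E_def)
  have [measurable]: "E m \<in> sets borel" for m
    unfolding E_eq by measurable
  have "(\<lambda>m. \<integral>\<^sup>+\<xi>. ennreal ((cmod (f \<xi>))\<^sup>2) * indicator (- E m) \<xi> \<partial>lborel) \<longlonglongrightarrow> (\<integral>\<^sup>+\<xi>. 0 \<partial>(lborel :: (real ^ 'n) measure))"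
  proof (rule nn_integral_dominated_convergence[OF _ _ _ _ L2])
    show "AE \<xi> in lborel. (\<lambda>m. ennreal ((cmod (f \<xi>))\<^sup>2) * indicator (- E m) \<xi>) \<longlonglongrightarrow> 0"
    proof (rule AE_I2)
      fix \<xi> :: "real ^ 'n"
      have "\<forall>\<^sub>F m in sequentially. ennreal ((cmod (f \<xi>))\<^sup>2) * indicator (- E m) \<xi> = 0"
        using eventually_ge_at_top[of "nat \<lceil>max (cmod (f \<xi>)) (norm \<xi>)\<rceil>"]
      proof eventually_elim
        case (elim m)
        then have "max (cmod (f \<xi>)) (norm \<xi>) \<le> real m" by linarith
        moreover have "\<bar>\<xi> $ j\<bar> \<le> norm \<xi>" for j by (rule component_le_norm_cart)
        ultimately have "\<xi> \<in> E m" by (auto simp: E_def intro: order_trans)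
        then show ?case by simp
      qed
      then show "(\<lambda>m. ennreal ((cmod (f \<xi>))\<^sup>2) * indicator (- E m) \<xi>) \<longlonglongrightarrow> 0"
        by (rule tendsto_eventually)
    qed
  qed (auto simp: indicator_def)
  then have "\<forall>\<^sub>F m in sequentially. (\<integral>\<^sup>+\<xi>. ennreal ((cmod (f \<xi>))\<^sup>2) * indicator (- E m) \<xi> \<partial>lborel) < ennreal (\<delta> * \<epsilon> / 3)"
    using \<delta> \<epsilon> by (intro order_tendstoD(2)) auto
  then obtain m where tail: "(\<integral>\<^sup>+\<xi>. ennreal ((cmod (f \<xi>))\<^sup>2) * indicator (- E m) \<xi> \<partial>lborel) < ennreal (\<delta> * \<epsilon> / 3)"
    using eventually_happens'[OF sequentially_bot] by blast
  \<comment> \<open>The bound m for f on \<open>E m\<close> times the box estimate with R = m, apart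
    from the factor 1 / sqrt (y $ k).\<close>
  define C where "C = real m * (2 * real m * (2 * real m + pi) ^ (n - 1))"
  have C: "0 \<le> C" by (simp add: C_def)
  \<comment> \<open>The norm is at most the sum of the n coordinates, so \<open>T <= norm y\<close>
    forces one coordinate above (3 C / \<epsilon>)^2, and the box contributes at most
    \<epsilon>/3.\<close>
  define T where "T = real n * ((3 * C / \<epsilon>)\<^sup>2 + 1)"
  have "(\<integral>\<^sup>+\<xi>. ennreal (cmod (f \<xi>) * half_Poisson x y \<xi>) \<partial>lborel) \<le> ennreal \<epsilon>"
    if y: "y \<in> octant" and far: "T \<le> norm y" for x y
  proof -
    have pos: "0 < y $ j" for j using y by (simp add: octant_def)
    have "\<exists>j. (3 * C / \<epsilon>)\<^sup>2 + 1 \<le> y $ j"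
    proof (rule ccontr)
      assume "\<not> ?thesis"
      then have "(\<Sum>j\<in>UNIV. \<bar>y $ j\<bar>) < (\<Sum>j\<in>(UNIV :: 'n set). (3 * C / \<epsilon>)\<^sup>2 + 1)"
        using pos by (intro sum_strict_mono) (auto simp: not_le less_imp_le)
      also have "\<dots> = T" by (simp add: T_def n_def)
      finally show False using norm_le_l1_cart[of y] far by linarith
    qed
    then obtain k where k: "(3 * C / \<epsilon>)\<^sup>2 + 1 \<le> y $ k" by blast
    have "3 * C / \<epsilon> \<le> sqrt (y $ k)" by (rule real_le_rsqrt) (use k in linarith)
    then have Ck: "C / sqrt (y $ k) \<le> \<epsilon> / 3"
      using pos[of k] \<epsilon> by (simp add: field_simps)
    define B where "B = {\<xi> :: real ^ 'n. \<forall>j. \<bar>\<xi> $ j\<bar> \<le> real m}"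
    have B_eq: "B = (\<Inter>j. {\<xi>\<in>space borel. \<bar>\<xi> $ j\<bar> \<le> real m})" by (auto simp: B_def)
    have [measurable]: "B \<in> sets borel" unfolding B_eq by measurable
    have q0: "0 \<le> half_Poisson x y \<xi>" for \<xi> by (rule half_Poisson_nonneg[OF y])
    have "(\<integral>\<^sup>+\<xi>. ennreal (cmod (f \<xi>) * half_Poisson x y \<xi>) \<partial>lborel)
        \<le> (\<integral>\<^sup>+\<xi>. ennreal (real m) * ennreal (half_Poisson x y \<xi> * indicator B \<xi>)
            + (ennreal (1 / \<delta>) * (ennreal ((cmod (f \<xi>))\<^sup>2) * indicator (- E m) \<xi>)
            + ennreal \<delta> * ennreal ((half_Poisson x y \<xi>)\<^sup>2)) \<partial>lborel)"
    proof (rule nn_integral_mono)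
      fix \<xi>
      show "ennreal (cmod (f \<xi>) * half_Poisson x y \<xi>) \<le> ennreal (real m) * ennreal (half_Poisson x y \<xi> * indicator B \<xi>)
            + (ennreal (1 / \<delta>) * (ennreal ((cmod (f \<xi>))\<^sup>2) * indicator (- E m) \<xi>)
            + ennreal \<delta> * ennreal ((half_Poisson x y \<xi>)\<^sup>2))"
      proof (cases "\<xi> \<in> E m")
        case True
        then have "cmod (f \<xi>) * half_Poisson x y \<xi> \<le> real m * (half_Poisson x y \<xi> * indicator B \<xi>)"
          using q0[of \<xi>] by (auto simp: E_def B_def intro: mult_right_mono)
        then have "ennreal (cmod (f \<xi>) * half_Poisson x y \<xi>) \<le> ennreal (real m) * ennreal (half_Poisson x y \<xi> * indicator B \<xi>)"
          using q0[of \<xi>] by (subst ennreal_mult[symmetric]) (auto intro: ennreal_leI)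
        then show ?thesis by (rule order_trans) simp
      next
        case False
        define u where "u = cmod (f \<xi>) / sqrt \<delta>"
        define v where "v = sqrt \<delta> * half_Poisson x y \<xi>"
        have "u * v \<le> u\<^sup>2 + v\<^sup>2"
        proof -
          have "0 \<le> u * v" using q0[of \<xi>] \<delta> by (simp add: u_def v_def)
          then show ?thesis using sum_squares_bound[of u v] by simp
        qed
        then have "cmod (f \<xi>) * half_Poisson x y \<xi> \<le> 1 / \<delta> * (cmod (f \<xi>))\<^sup>2 + \<delta> * (half_Poisson x y \<xi>)\<^sup>2"
          using \<delta> by (simp add: u_def v_def power_divide power_mult_distrib)
        then have "ennreal (cmod (f \<xi>) * half_Poisson x y \<xi>)
            \<le> ennreal (1 / \<delta>) * ennreal ((cmod (f \<xi>))\<^sup>2) + ennreal \<delta> * ennreal ((half_Poisson x y \<xi>)\<^sup>2)"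
          using \<delta> by (simp add: ennreal_leI flip: ennreal_mult ennreal_plus)
        then show ?thesis using False by (simp add: add_increasing)
      qed
    qed
    also have "\<dots> = ennreal (real m) * (\<integral>\<^sup>+\<xi>. ennreal (half_Poisson x y \<xi> * indicator B \<xi>) \<partial>lborel)
        + (ennreal (1 / \<delta>) * (\<integral>\<^sup>+\<xi>. ennreal ((cmod (f \<xi>))\<^sup>2) * indicator (- E m) \<xi> \<partial>lborel)
        + ennreal \<delta> * (\<integral>\<^sup>+\<xi>. ennreal ((half_Poisson x y \<xi>)\<^sup>2) \<partial>lborel))"
      by (simp add: nn_integral_add nn_integral_cmult)
    also have "\<dots> \<le> ennreal (\<epsilon> / 3) + (ennreal (\<epsilon> / 3) + ennreal (\<epsilon> / 3))"
    proof (intro add_mono)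
      have "ennreal (real m) * (\<integral>\<^sup>+\<xi>. ennreal (half_Poisson x y \<xi> * indicator B \<xi>) \<partial>lborel)
          \<le> ennreal (real m) * ennreal (2 * real m / sqrt (y $ k) * (2 * real m + pi) ^ (n - 1))"
        unfolding B_def n_def by (intro mult_left_mono nn_integral_half_Poisson_box y) auto
      also have "\<dots> = ennreal (C / sqrt (y $ k))"
        using pos[of k] by (subst ennreal_mult[symmetric]) (auto simp: C_def less_imp_le)
      also have "\<dots> \<le> ennreal (\<epsilon> / 3)" by (rule ennreal_leI[OF Ck])
      finally show "ennreal (real m) * (\<integral>\<^sup>+\<xi>. ennreal (half_Poisson x y \<xi> * indicator B \<xi>) \<partial>lborel) \<le> ennreal (\<epsilon> / 3)" .
      have "ennreal (1 / \<delta>) * (\<integral>\<^sup>+\<xi>. ennreal ((cmod (f \<xi>))\<^sup>2) * indicator (- E m) \<xi> \<partial>lborel) \<le> ennreal (1 / \<delta>) * ennreal (\<delta> * \<epsilon> / 3)"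
        by (intro mult_left_mono less_imp_le[OF tail]) simp
      also have "\<dots> = ennreal (\<epsilon> / 3)" using \<delta> \<epsilon> by (subst ennreal_mult[symmetric]) auto
      finally show "ennreal (1 / \<delta>) * (\<integral>\<^sup>+\<xi>. ennreal ((cmod (f \<xi>))\<^sup>2) * indicator (- E m) \<xi> \<partial>lborel) \<le> ennreal (\<epsilon> / 3)" .
      have "ennreal \<delta> * (\<integral>\<^sup>+\<xi>. ennreal ((half_Poisson x y \<xi>)\<^sup>2) \<partial>lborel) \<le> ennreal \<delta> * ennreal (pi ^ n)"
        unfolding n_def by (intro mult_left_mono nn_integral_half_Poisson_squared y) simp
      also have "\<dots> = ennreal (\<epsilon> / 3)" using \<delta> by (subst ennreal_mult[symmetric]) (auto simp: \<delta>_def)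
      finally show "ennreal \<delta> * (\<integral>\<^sup>+\<xi>. ennreal ((half_Poisson x y \<xi>)\<^sup>2) \<partial>lborel) \<le> ennreal (\<epsilon> / 3)" .
    qed
    also have "\<dots> = ennreal \<epsilon>" using \<epsilon> by (simp flip: ennreal_plus)
    finally show ?thesis .
  qed
  then show ?thesis by blast
qed

text \<open>A non-integrable g has integral 0 by convention, so the bound is unconditional and can
  be applied to \<open>hardy_inner\<close> directly.\<close>

lemma norm_lebesgue_integral_le_nn_integral:
  fixes g :: "'a \<Rightarrow> 'b::{banach, second_countable_topology}"
  shows "ennreal (norm (integral\<^sup>L M g)) \<le> (\<integral>\<^sup>+x. ennreal (norm (g x)) \<partial>M)"
  by (cases "integrable M g") (auto simp: integral_norm_bound_ennreal not_integrable_integral_eq)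

theorem lemma4p4:
  fixes F :: "complex ^ 'n \<Rightarrow> complex" and \<alpha> :: "'n \<Rightarrow> nat"
  assumes "F \<in> hardy_space"
  shows "uniform_limit UNIV
           (\<lambda>(y :: real ^ 'n) (x :: real ^ 'n).
              cmod (hardy_inner F (phi \<alpha> (cvec x y))) / hardy_norm (phi \<alpha> (cvec x y)))
           (\<lambda>x. 0)
           (inf at_infinity (principal octant))"
proof (rule uniform_limitI)
  fix \<epsilon> :: real assume \<epsilon>: "0 < \<epsilon>"
  define K where "K = (\<Prod>j\<in>(UNIV :: 'n set). sqrt 5 ^ (\<alpha> j + 1))"
  have K: "0 < K" unfolding K_def by (intro prod_pos) auto
  define f where "f = boundary_fun F"
  obtain f' where "is_boundary_fun F f'" using boundary_fun_exists[OF assms] by blast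
  then have f: "is_boundary_fun F f" unfolding f_def by (rule is_boundary_fun_boundary_fun)
  then have [measurable]: "f \<in> borel_measurable borel" by (simp add: is_boundary_fun_def)
  \<comment> \<open>The factor K lost in comparing the kernel with its norm cancels the K here; the
    2 leaves room for the strict inequality.\<close>
  have "\<exists>T. \<forall>x. \<forall>y\<in>octant. T \<le> norm y \<longrightarrow>
      (\<integral>\<^sup>+\<xi>. ennreal (cmod (f \<xi>) * half_Poisson x y \<xi>) \<partial>lborel) \<le> ennreal (\<epsilon> / (2 * K))"
    using f \<epsilon> K by (intro half_Poisson_vanishes) (auto simp: is_boundary_fun_def)
  then obtain T where T: "\<And>x y. y \<in> octant \<Longrightarrow> T \<le> norm y \<Longrightarrow>
      (\<integral>\<^sup>+\<xi>. ennreal (cmod (f \<xi>) * half_Poisson x y \<xi>) \<partial>lborel) \<le> ennreal (\<epsilon> / (2 * K))"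
    by blast
  have bound: "cmod (hardy_inner F (phi \<alpha> (cvec x y))) / hardy_norm (phi \<alpha> (cvec x y)) < \<epsilon>"
    if y: "y \<in> octant" and far: "T \<le> norm y" for x y
  proof -
    define N where "N = hardy_norm (phi \<alpha> (cvec x y))"
    have N0: "0 \<le> N" by (simp add: N_def hardy_norm_def)
    have "ennreal (cmod (hardy_inner F (phi \<alpha> (cvec x y))))
        \<le> (\<integral>\<^sup>+\<xi>. ennreal (cmod (f \<xi> * cnj (boundary_fun (phi \<alpha> (cvec x y)) \<xi>))) \<partial>lborel)"
      unfolding hardy_inner_def f_def by (rule norm_lebesgue_integral_le_nn_integral)
    also have "\<dots> \<le> (\<integral>\<^sup>+\<xi>. ennreal (N * K) * ennreal (cmod (f \<xi>) * half_Poisson x y \<xi>) \<partial>lborel)"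
    proof (rule nn_integral_mono_AE, use boundary_fun_phi[OF y] in eventually_elim)
      fix \<xi> assume eq: "boundary_fun (phi \<alpha> (cvec x y)) \<xi> = phi_formula (cvec \<xi> 0) \<alpha> (cvec x y)"
      have "cmod (phi_formula (cvec \<xi> 0) \<alpha> (cvec x y)) \<le> phi_scale \<alpha> y * (\<Prod>j\<in>UNIV. sqrt (y $ j)) * half_Poisson x y \<xi>"
        by (rule norm_phi_formula_boundary_le[OF y])
      also have "\<dots> \<le> (N * K) * half_Poisson x y \<xi>"
        using hardy_norm_phi_ge[OF y] half_Poisson_nonneg[OF y]
        unfolding N_def K_def by (intro mult_right_mono)
      finally have "cmod (f \<xi>) * cmod (phi_formula (cvec \<xi> 0) \<alpha> (cvec x y)) \<le> cmod (f \<xi>) * (N * K * half_Poisson x y \<xi>)"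
        by (rule mult_left_mono) simp
      then show "ennreal (cmod (f \<xi> * cnj (boundary_fun (phi \<alpha> (cvec x y)) \<xi>)))
          \<le> ennreal (N * K) * ennreal (cmod (f \<xi>) * half_Poisson x y \<xi>)"
        using N0 K half_Poisson_nonneg[OF y, of x \<xi>]
        by (simp add: eq norm_mult ennreal_leI mult_ac flip: ennreal_mult)
    qed
    also have "\<dots> = ennreal (N * K) * (\<integral>\<^sup>+\<xi>. ennreal (cmod (f \<xi>) * half_Poisson x y \<xi>) \<partial>lborel)"
      by (rule nn_integral_cmult) measurable
    also have "\<dots> \<le> ennreal (N * K) * ennreal (\<epsilon> / (2 * K))"
      by (intro mult_left_mono T y far) simp
    also have "\<dots> = ennreal (N * (\<epsilon> / 2))"
      using N0 K \<epsilon> by (subst ennreal_mult[symmetric]) auto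
    finally have le: "cmod (hardy_inner F (phi \<alpha> (cvec x y))) \<le> N * (\<epsilon> / 2)"
      using N0 \<epsilon> by (subst (asm) ennreal_le_iff) auto
    have "cmod (hardy_inner F (phi \<alpha> (cvec x y))) / N \<le> \<epsilon> / 2"
    \<comment> \<open>For N = 0 the quotient is 0 by the convention for division by zero.\<close>
    proof (cases "N = 0")
      case False
      with N0 le show ?thesis by (simp add: pos_divide_le_eq mult.commute)
    qed (use \<epsilon> in simp)
    then show ?thesis using \<epsilon> unfolding N_def by linarith
  qed
  have "\<forall>\<^sub>F y in at_infinity. y \<in> octant \<longrightarrow>
      (\<forall>x\<in>UNIV. dist (cmod (hardy_inner F (phi \<alpha> (cvec x y))) / hardy_norm (phi \<alpha> (cvec x y))) 0 < \<epsilon>)"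
    unfolding eventually_at_infinity
  \<comment> \<open>T was chosen before x, which is what makes the limit uniform.\<close>
  proof (intro exI[of _ T] allI impI ballI)
    fix x y :: "real ^ 'n" assume "T \<le> norm y" "y \<in> octant"
    moreover have "0 \<le> hardy_norm (phi \<alpha> (cvec x y))" by (simp add: hardy_norm_def)
    ultimately show "dist (cmod (hardy_inner F (phi \<alpha> (cvec x y))) / hardy_norm (phi \<alpha> (cvec x y))) 0 < \<epsilon>"
      using bound by (simp add: dist_real_def)
  qed
  then show "\<forall>\<^sub>F y in inf at_infinity (principal octant). \<forall>x\<in>UNIV.
      dist (cmod (hardy_inner F (phi \<alpha> (cvec x y))) / hardy_norm (phi \<alpha> (cvec x y))) 0 < \<epsilon>"
    by (simp only: eventually_inf_principal)
qed

end
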